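(* Let $\{d_k\}_{k=1}^\infty\in\ell^2(\mathbb{N})$ and $d_kd_{k+2}\ge d_{k+1}^2$ for all $k\in\mathbb{N}$. If $$\sum_{k=1}^\infty d_{k+1}\left\|\Lambda_k+\left(\frac1{d_k}+\frac1{d_{k+1}}\right)\mathrm{I}_p\right\|_{\mathbb{C}^p}<\infty,$$ then $n_\pm(H_{X,\Lambda})=p$.
   Context: Let $p\in\mathbb{N}$, $\mathbb{R}_+=(0,\infty)$. Let $X=\{x_k\}_{k=0}^\infty$ be strictly increasing with $x_0=0$ and $\lim_{k\to\infty}x_k=\infty$; $d_k:=x_k-x_{k-1}$ for $k\in\mathbb{N}$, with $\sup_kd_k<\infty$. Let $\Lambda=\{\Lambda_k\}_{k=1}^\infty\subset\mathbb{C}^{p\times p}$ with $\Lambda_k=\Lambda_k^*$. $\mathrm{I}_p$ is the identity matrix and $\|\cdot\|_{\mathbb{C}^p}$ the operator norm of matrices on $\mathbb{C}^p$. $H_{X,\Lambda}$ is the closure in $L^2(\mathbb{R}_+;\mathbb{C}^p)$ of the operator acting as $f\mapsto-f''$ (on each interval $(x_{k-1},x_k)$) on all $f$ with compact support in $[0,\infty)$, with restrictions in $W^{2,2}([x_{k-1},x_k];\mathbb{C}^p)$ for every $k$, and with $f'(0)=0$, $f(x_k+)=f(x_k-)$, $f'(x_k+)-f'(x_k-)=\Lambda_kf(x_k)$, $k\in\mathbb{N}$. For a densely defined closed symmetric operator $T$, $n_\pm(T):=\dim\ker(T^*\mp\mathrm{i})$ are its deficiency indices; $n_\pm(T)=p$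 means both equal $p$. *)

theory Defs
  imports "HOL-Analysis.Analysis" "HOL-Library.Extended_Nat"
begin

section \<open>The Hilbert space of square-integrable vector functions on the half-line\<close>

text \<open>
  Functions on the half-line are total functions on the reals whose values on the
  non-positive axis are irrelevant.
\<close>

abbreviation halfline :: "real measure"
  where "halfline \<equiv> lebesgue_on {0<..}"

definition square_integrable :: "real measure \<Rightarrow> (real \<Rightarrow> complex ^ 'p) \<Rightarrow> bool"
  where "square_integrable M f \<longleftrightarrow>
    f \<in> borel_measurable M \<and> integrable M (\<lambda>t. (norm (f t))\<^sup>2)"

definition vec_cinner :: "complex ^ 'p \<Rightarrow> complex ^ 'p \<Rightarrow> complex"
  where "vec_cinner v w = (\<Sum>i\<in>UNIV. v $ i * cnj (w $ i))"

lemma vec_cinner_add_left: "vec_cinner (u + v) w = vec_cinner u w + vec_cinner v w"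
  by (simp add: vec_cinner_def distrib_right sum.distrib)

lemma vec_cinner_scale_left: "vec_cinner (c *s v) w = c * vec_cinner v w"
  by (simp add: vec_cinner_def sum_distrib_left mult.assoc)

lemma vec_cinner_commute: "vec_cinner v w = cnj (vec_cinner w v)"
  by (simp add: vec_cinner_def mult.commute)

lemma vec_cinner_self: "vec_cinner v v = of_real ((norm v)\<^sup>2)"
proof -
  have "vec_cinner v v = (\<Sum>i\<in>UNIV. of_real ((norm (v $ i))\<^sup>2))"
    unfolding vec_cinner_def by (intro sum.cong refl) (simp only: complex_norm_square)
  also have "\<dots> = of_real ((norm v)\<^sup>2)"
    by (simp add: norm_vec_def L2_set_def sum_nonneg)
  finally show ?thesis .
qed

lemma norm_scalar_mult_vec: "norm (c *s v) = norm c * norm (v :: complex ^ 'p)"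
  by (simp add: norm_vec_def L2_set_right_distrib norm_mult)

lemma norm_vec_cinner_le: "norm (vec_cinner v w) \<le> of_nat CARD('p) * ((norm v)\<^sup>2 + (norm w)\<^sup>2)"
  for v w :: "complex ^ 'p"
proof -
  have "norm (v $ i * cnj (w $ i)) \<le> (norm v)\<^sup>2 + (norm w)\<^sup>2" for i
  proof -
    have "norm (v $ i * cnj (w $ i)) \<le> norm v * norm w"
      by (simp add: norm_mult mult_mono Finite_Cartesian_Product.norm_nth_le)
    also have "\<dots> \<le> (norm v)\<^sup>2 + (norm w)\<^sup>2"
      using sum_squares_bound[of "norm v" "norm w"]
        mult_nonneg_nonneg[OF norm_ge_zero[of v] norm_ge_zero[of w]]
      by (simp only: mult.assoc)
    finally show ?thesis .
  qed
  then show ?thesis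
    unfolding vec_cinner_def by (intro sum_norm_bound[THEN order_trans]) auto
qed

lemma vec_cinner_measurable [measurable]:
  fixes f g :: "'a \<Rightarrow> complex ^ 'p"
  assumes [measurable]: "f \<in> borel_measurable M" "g \<in> borel_measurable M"
  shows "(\<lambda>t. vec_cinner (f t) (g t)) \<in> borel_measurable M"
proof -
  have nth: "(\<lambda>v :: complex ^ 'p. v $ i) \<in> borel_measurable borel" for i
    by (intro borel_measurable_continuous_onI continuous_intros)
  have cnj: "cnj \<in> borel_measurable borel"
    by (intro borel_measurable_continuous_onI continuous_intros)
  have "(\<lambda>t. f t $ i) \<in> borel_measurable M" "(\<lambda>t. cnj (g t $ i)) \<in> borel_measurable M" for i
    using measurable_compose[OF assms(1) nth]
      measurable_compose[OF measurable_compose[OF assms(2) nth] cnj] by auto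
  then show ?thesis unfolding vec_cinner_def by measurable
qed

lemma scalar_mult_measurable:
  fixes f :: "'a \<Rightarrow> complex ^ 'p"
  assumes "f \<in> borel_measurable M"
  shows "(\<lambda>t. c *s f t) \<in> borel_measurable M"
proof -
  have "linear (\<lambda>v :: complex ^ 'p. c *s v)"
    by (auto intro!: linearI simp: vec_eq_iff algebra_simps)
  then have "(\<lambda>v :: complex ^ 'p. c *s v) \<in> borel_measurable borel"
    by (intro borel_measurable_continuous_onI linear_continuous_on)
      (simp add: linear_conv_bounded_linear)
  from measurable_compose[OF assms this] show ?thesis .
qed

lemma square_integrable_zero: "square_integrable M (\<lambda>t. 0)"
  by (simp add: square_integrable_def)

lemma square_integrable_scale:
  "square_integrable M f \<Longrightarrow> square_integrable M (\<lambda>t. c *s f t)"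
  by (auto simp: square_integrable_def norm_scalar_mult_vec power_mult_distrib
      intro!: scalar_mult_measurable)

lemma square_integrable_add:
  assumes "square_integrable M f" "square_integrable M g"
  shows "square_integrable M (\<lambda>t. f t + g t)"
proof -
  from assms have [measurable]: "f \<in> borel_measurable M" "g \<in> borel_measurable M"
    and int: "integrable M (\<lambda>t. (norm (f t))\<^sup>2)" "integrable M (\<lambda>t. (norm (g t))\<^sup>2)"
    by (auto simp: square_integrable_def)
  have "integrable M (\<lambda>t. (norm (f t + g t))\<^sup>2)"
  proof (rule Bochner_Integration.integrable_bound)
    show "integrable M (\<lambda>t. 2 * (norm (f t))\<^sup>2 + 2 * (norm (g t))\<^sup>2)"
      using int by auto
    have "(norm (v + w))\<^sup>2 \<le> 2 * (norm v)\<^sup>2 + 2 * (norm w)\<^sup>2" for v w :: "complex ^ 'p"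
    proof -
      have "(norm (v + w))\<^sup>2 \<le> (norm v + norm w)\<^sup>2"
        by (intro power_mono norm_triangle_ineq) auto
      also have "\<dots> \<le> 2 * (norm v)\<^sup>2 + 2 * (norm w)\<^sup>2"
        using sum_squares_bound[of "norm v" "norm w"] by (simp add: power2_sum)
      finally show ?thesis .
    qed
    then show "AE t in M. norm ((norm (f t + g t))\<^sup>2)
        \<le> norm (2 * (norm (f t))\<^sup>2 + 2 * (norm (g t))\<^sup>2)"
      by auto
  qed measurable
  then show ?thesis by (simp add: square_integrable_def)
qed

lemma integrable_vec_cinner:
  assumes "square_integrable M f" "square_integrable M g"
  shows "integrable M (\<lambda>t. vec_cinner (f t) (g t))"
proof -
  from assms have [measurable]: "f \<in> borel_measurable M" "g \<in> borel_measurable M"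
    and int: "integrable M (\<lambda>t. (norm (f t))\<^sup>2)" "integrable M (\<lambda>t. (norm (g t))\<^sup>2)"
    by (auto simp: square_integrable_def)
  show ?thesis
  proof (rule Bochner_Integration.integrable_bound)
    show "integrable M (\<lambda>t. of_nat CARD('a) * ((norm (f t))\<^sup>2 + (norm (g t))\<^sup>2))"
      using int by auto
    show "AE t in M. norm (vec_cinner (f t) (g t))
        \<le> norm (of_nat CARD('a) * ((norm (f t))\<^sup>2 + (norm (g t))\<^sup>2) :: real)"
      using norm_vec_cinner_le[of "f _" "g _"] by (auto simp: abs_mult)
  qed measurable
qed

definition L2_eq :: "(real \<Rightarrow> complex ^ 'p) \<Rightarrow> (real \<Rightarrow> complex ^ 'p) \<Rightarrow> bool"
  where "L2_eq f g \<longleftrightarrow> square_integrable halfline f \<and> square_integrable halfline g \<and>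
    (AE t in halfline. f t = g t)"

quotient_type (overloaded) 'p L2 = "real \<Rightarrow> complex ^ ('p::finite)" / partial: L2_eq
proof (rule part_equivpI)
  show "\<exists>f :: real \<Rightarrow> complex ^ 'p. L2_eq f f"
    by (rule exI[of _ "\<lambda>_. 0"]) (simp add: L2_eq_def square_integrable_zero)
  show "symp (L2_eq :: (real \<Rightarrow> complex ^ 'p) \<Rightarrow> _)"
    by (auto simp: symp_def L2_eq_def)
  show "transp (L2_eq :: (real \<Rightarrow> complex ^ 'p) \<Rightarrow> _)"
    unfolding transp_def L2_eq_def by (auto elim!: eventually_elim2)
qed

text \<open>The class of \<open>f\<close>; meaningful only if \<open>f\<close> is square-integrable.\<close>

definition to_L2 :: "(real \<Rightarrow> complex ^ 'p) \<Rightarrow> ('p::finite) L2"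
  where "to_L2 f = abs_L2 f"

lift_definition cscale :: "complex \<Rightarrow> ('p::finite) L2 \<Rightarrow> 'p L2" is "\<lambda>c f t. c *s f t"
  by (auto simp: L2_eq_def intro: square_integrable_scale)

text \<open>The complex inner product, linear in its first argument.\<close>

lift_definition cinner :: "('p::finite) L2 \<Rightarrow> 'p L2 \<Rightarrow> complex"
  is "\<lambda>f g. integral\<^sup>L halfline (\<lambda>t. vec_cinner (f t) (g t))"
proof -
  fix f f' g g' :: "real \<Rightarrow> complex ^ 'p"
  assume "L2_eq f f'" "L2_eq g g'"
  then have [measurable]: "f \<in> borel_measurable halfline" "f' \<in> borel_measurable halfline"
      "g \<in> borel_measurable halfline" "g' \<in> borel_measurable halfline"
    and ae: "AE t in halfline. f t = f' t" "AE t in halfline. g t = g' t"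
    by (auto simp: L2_eq_def square_integrable_def)
  show "integral\<^sup>L halfline (\<lambda>t. vec_cinner (f t) (g t)) =
      integral\<^sup>L halfline (\<lambda>t. vec_cinner (f' t) (g' t))"
    by (rule integral_cong_AE) (use ae in auto)
qed

instantiation L2 :: (finite) ab_group_add
begin

lift_definition zero_L2 :: "'a L2" is "\<lambda>t. 0"
  by (simp add: L2_eq_def square_integrable_zero)

lift_definition plus_L2 :: "'a L2 \<Rightarrow> 'a L2 \<Rightarrow> 'a L2" is "\<lambda>f g t. f t + g t"
  by (auto simp: L2_eq_def intro: square_integrable_add)

definition uminus_L2 :: "'a L2 \<Rightarrow> 'a L2"
  where "uminus_L2 u = cscale (-1) u"

definition minus_L2 :: "'a L2 \<Rightarrow> 'a L2 \<Rightarrow> 'a L2"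
  where "minus_L2 u v = u + - v"

instance
proof
  fix u v w :: "'a L2"
  show "u + v + w = u + (v + w)"
    by transfer (auto simp: L2_eq_def add.assoc intro!: square_integrable_add)
  show "u + v = v + u"
    by transfer (auto simp: L2_eq_def add.commute intro!: square_integrable_add)
  show "0 + u = u"
    by transfer (auto simp: L2_eq_def)
  show "- u + u = 0"
    unfolding uminus_L2_def
    by transfer
      (auto simp: L2_eq_def square_integrable_zero
        intro!: square_integrable_add square_integrable_scale)
  show "u - v = u + - v"
    by (rule minus_L2_def)
qed

end

lemma cscale_add_right: "cscale c (u + v) = cscale c u + cscale c v"
  by transfer (auto simp: L2_eq_def vector_add_ldistrib
      intro!: square_integrable_add square_integrable_scale)

lemma cscale_add_left: "cscale (c + d) u = cscale c u + cscale d u"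
  by transfer (auto simp: L2_eq_def vec_eq_iff distrib_right
      intro!: square_integrable_add square_integrable_scale)

lemma cscale_cscale: "cscale c (cscale d u) = cscale (c * d) u"
  by transfer (auto simp: L2_eq_def intro!: square_integrable_scale)

lemma cscale_one: "cscale 1 u = u"
  by transfer (auto simp: L2_eq_def)

lemma cinner_add_left: "cinner (u + v) w = cinner u w + cinner v w"
  by transfer (auto simp: L2_eq_def vec_cinner_add_left
      intro!: Bochner_Integration.integral_add integrable_vec_cinner)

lemma cinner_cscale_left: "cinner (cscale c u) w = c * cinner u w"
  by transfer (auto simp: vec_cinner_scale_left)

lemma cinner_commute: "cinner u w = cnj (cinner w u)"
  by transfer (subst vec_cinner_commute, simp)

lemma cinner_self_transfer:
  assumes "square_integrable halfline f"
  shows "integral\<^sup>L halfline (\<lambda>t. vec_cinner (f t) (f t)) =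
    of_real (integral\<^sup>L halfline (\<lambda>t. (norm (f t))\<^sup>2))"
  by (simp add: vec_cinner_self del: of_real_power)

lemma Re_cinner_self_nonneg: "0 \<le> Re (cinner u u)"
  by transfer (auto simp: L2_eq_def cinner_self_transfer)

lemma Re_cinner_self_eq_0_iff: "Re (cinner u u) = 0 \<longleftrightarrow> u = 0"
proof (transfer, goal_cases)
  case (1 f)
  then have sq: "square_integrable halfline f"
    and int: "integrable halfline (\<lambda>t. (norm (f t))\<^sup>2)"
    by (auto simp: L2_eq_def square_integrable_def)
  show ?case
    using sq integral_nonneg_eq_0_iff_AE[OF int]
    by (simp add: L2_eq_def cinner_self_transfer square_integrable_zero)
qed

instantiation L2 :: (finite) real_vector
begin

definition scaleR_L2 :: "real \<Rightarrow> 'a L2 \<Rightarrow> 'a L2"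
  where "scaleR_L2 r u = cscale (of_real r) u"

instance
proof
  fix u v :: "'a L2" and r s :: real
  show "r *\<^sub>R (u + v) = r *\<^sub>R u + r *\<^sub>R v" "(r + s) *\<^sub>R u = r *\<^sub>R u + s *\<^sub>R u"
    "r *\<^sub>R s *\<^sub>R u = (r * s) *\<^sub>R u" "1 *\<^sub>R u = u"
    by (simp_all add: scaleR_L2_def cscale_add_right cscale_add_left cscale_cscale cscale_one)
qed

end

instantiation L2 :: (finite) real_inner
begin

definition inner_L2 :: "'a L2 \<Rightarrow> 'a L2 \<Rightarrow> real"
  where "inner_L2 u v = Re (cinner u v)"

definition norm_L2 :: "'a L2 \<Rightarrow> real"
  where "norm_L2 u = sqrt (u \<bullet> u)"

definition dist_L2 :: "'a L2 \<Rightarrow> 'a L2 \<Rightarrow> real"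
  where "dist_L2 u v = norm (u - v)"

definition sgn_L2 :: "'a L2 \<Rightarrow> 'a L2"
  where "sgn_L2 u = u /\<^sub>R norm u"

definition uniformity_L2 :: "('a L2 \<times> 'a L2) filter"
  where "uniformity_L2 = (INF e\<in>{0<..}. principal {(u, v). dist u v < e})"

definition open_L2 :: "'a L2 set \<Rightarrow> bool"
  where "open_L2 U \<longleftrightarrow> (\<forall>u\<in>U. \<forall>\<^sub>F (u', v) in uniformity. u' = u \<longrightarrow> v \<in> U)"

instance
proof
  fix u v w :: "'a L2" and r :: real
  show "sgn u = u /\<^sub>R norm u" "dist u v = norm (u - v)" "norm u = sqrt (u \<bullet> u)"
    by (simp_all add: sgn_L2_def dist_L2_def norm_L2_def)
  show "u \<bullet> v = v \<bullet> u"
    unfolding inner_L2_def by (subst cinner_commute) simp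
  show "(u + v) \<bullet> w = u \<bullet> w + v \<bullet> w" "(r *\<^sub>R u) \<bullet> v = r * (u \<bullet> v)"
    by (simp_all add: inner_L2_def scaleR_L2_def cinner_add_left cinner_cscale_left)
  show "0 \<le> u \<bullet> u" "(u \<bullet> u = 0) = (u = 0)"
    by (simp_all add: inner_L2_def Re_cinner_self_nonneg Re_cinner_self_eq_0_iff)
qed (simp_all add: uniformity_L2_def open_L2_def)

end

text \<open>\<open>L2\<close> as a complex vector space, giving complex spans and dimensions.\<close>

interpretation L2: vector_space "cscale :: complex \<Rightarrow> ('p::finite) L2 \<Rightarrow> 'p L2"
  by unfold_locales (simp_all add: cscale_add_right cscale_add_left cscale_cscale cscale_one)

section \<open>Unbounded operators and deficiency indices\<close>

text \<open>
  An operator is represented by its graph; the closure of an operator is the topological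
  \<^const>\<open>closure\<close> of its graph in the product space. The adjoint of a densely defined
  operator is the operator whose graph is the following set.
\<close>

definition adjoint_graph :: "(('p::finite) L2 \<times> 'p L2) set \<Rightarrow> ('p L2 \<times> 'p L2) set"
  where "adjoint_graph T = {(u, v). \<forall>(f, g)\<in>T. cinner g u = cinner f v}"

definition eigenkernel :: "(('p::finite) L2 \<times> 'p L2) set \<Rightarrow> complex \<Rightarrow> 'p L2 set"
  where "eigenkernel T z = {u. (u, cscale z u) \<in> T}"

text \<open>The library's \<open>L2.dim\<close> gives a natural number also to spaces of infinite dimension.\<close>

definition ecdim :: "('p::finite) L2 set \<Rightarrow> enat"
  where "ecdim V = (if \<exists>B. finite B \<and> V \<subseteq> L2.span B then enat (L2.dim V) else \<infinity>)"

definition deficiency_plus :: "(('p::finite) L2 \<times> 'p L2) set \<Rightarrow> enat"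
  where "deficiency_plus T = ecdim (eigenkernel (adjoint_graph T) \<i>)"

definition deficiency_minus :: "(('p::finite) L2 \<times> 'p L2) set \<Rightarrow> enat"
  where "deficiency_minus T = ecdim (eigenkernel (adjoint_graph T) (- \<i>))"

section \<open>Schroedinger operators with matrix point interactions\<close>

text \<open>
  \<open>ac_deriv a b f g\<close>: on the open interval, \<open>f\<close> agrees with an absolutely continuous
  function on the closed interval (an indefinite Lebesgue integral) whose derivative is \<open>g\<close>
  almost everywhere.
\<close>

definition ac_deriv :: "real \<Rightarrow> real \<Rightarrow> (real \<Rightarrow> complex ^ 'p) \<Rightarrow> (real \<Rightarrow> complex ^ 'p) \<Rightarrow> bool"
  where "ac_deriv a b f g \<longleftrightarrow> g absolutely_integrable_on {a<..<b} \<and>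
    (\<exists>c. \<forall>t\<in>{a<..<b}. f t = c + integral {a..t} g)"

text \<open>
  \<open>W22_derivs a b f f' f''\<close>: the restriction of \<open>f\<close> lies in the Sobolev space
  \<open>W\<^sup>2\<^sup>,\<^sup>2([a,b])\<close>, that is, \<open>f\<close> and \<open>f'\<close> are absolutely continuous and the
  second derivative is square-integrable; \<open>f'\<close> is the continuous first derivative, and
  \<open>f''\<close> the second derivative, which is determined almost everywhere. Values at the end
  points are to be read as one-sided limits.
\<close>

definition W22_derivs :: "real \<Rightarrow> real \<Rightarrow> (real \<Rightarrow> complex ^ 'p) \<Rightarrow> (real \<Rightarrow> complex ^ 'p) \<Rightarrow>
    (real \<Rightarrow> complex ^ 'p) \<Rightarrow> bool"
  where "W22_derivs a b f f' f'' \<longleftrightarrow> ac_deriv a b f f' \<and> ac_deriv a b f' f'' \<and>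
    square_integrable (lebesgue_on {a<..<b}) f''"

definition right_lim :: "(real \<Rightarrow> complex ^ 'p) \<Rightarrow> real \<Rightarrow> complex ^ 'p"
  where "right_lim f a = Lim (at_right a) f"

definition left_lim :: "(real \<Rightarrow> complex ^ 'p) \<Rightarrow> real \<Rightarrow> complex ^ 'p"
  where "left_lim f a = Lim (at_left a) f"

text \<open>
  The graph of \<open>f \<mapsto> -f''\<close> on compactly supported functions. The square-integrability
  conditions only make \<^const>\<open>to_L2\<close> meaningful: they follow from the other ones. The
  value of \<open>f\<close> at \<open>x k\<close> is the common one-sided limit. The matrix \<open>\<Lambda> 0\<close> is not used.
\<close>

definition pre_hamiltonian ::
    "(nat \<Rightarrow> real) \<Rightarrow> (nat \<Rightarrow> complex ^ 'p ^ 'p) \<Rightarrow> (('p::finite) L2 \<times> 'p L2) set"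
  where "pre_hamiltonian x \<Lambda> =
    {(to_L2 f, to_L2 (\<lambda>t. - f'' t)) | f f' f''.
      square_integrable halfline f \<and> square_integrable halfline f'' \<and>
      (\<exists>R. \<forall>t>R. f t = 0) \<and>
      (\<forall>k\<ge>1. W22_derivs (x (k - 1)) (x k) f f' f'') \<and>
      right_lim f' 0 = 0 \<and>
      (\<forall>k\<ge>1. right_lim f (x k) = left_lim f (x k) \<and>
        right_lim f' (x k) - left_lim f' (x k) = \<Lambda> k *v right_lim f (x k))}"

definition hamiltonian ::
    "(nat \<Rightarrow> real) \<Rightarrow> (nat \<Rightarrow> complex ^ 'p ^ 'p) \<Rightarrow> (('p::finite) L2 \<times> 'p L2) set"
  where "hamiltonian x \<Lambda> = closure (pre_hamiltonian x \<Lambda>)"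

definition hermitian :: "complex ^ 'p ^ 'p \<Rightarrow> bool"
  where "hermitian A \<longleftrightarrow> (\<forall>i j. A $ i $ j = cnj (A $ j $ i))"

definition matrix_opnorm :: "complex ^ 'p ^ 'p \<Rightarrow> real"
  where "matrix_opnorm A = onorm ((*v) A)"

text \<open>The gap \<open>d k\<close> is meant for \<open>k \<ge> 1\<close>.\<close>

definition gap :: "(nat \<Rightarrow> real) \<Rightarrow> nat \<Rightarrow> real"
  where "gap x k = x k - x (k - 1)"

end

(*
  The kernel of T^* - z, for T the Hamiltonian and z = i or -i, consists of the
  square-integrable solutions of -U'' = z U with U'(0) = 0 that satisfy the jump conditions.
  Without square-integrability these form a copy of C^p, parametrised by U(0), so everything
  hinges on all of them being square-integrable.

  Growth. Eliminating U' from the transfer relations leaves a three-term recurrence for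
  u_k = U(x_k). Because Lambda_k is close to -(1/d_k + 1/d_(k+1)), it reads
  u_(k+1)/d_(k+1) + u_(k-1)/d_k = (summably small). Positive weights with
  alpha_(k+1)/alpha_(k-1) = d_(k+1)/d_k and alpha_k alpha_(k+1) = d_(k+1) remove the main
  part, so |u_k|/alpha_k stays bounded. Log-convexity makes alpha_(k+1)/alpha_k monotone
  along even and along odd k, hence bounded below, which gives alpha_k^2 <= C d_(k+1) and
  finally a bound of the squared norm of U by a multiple of the sum of the d_k^2.

  Kernel. No weak regularity theory is needed: let v be in the kernel and let h be v - U_c cut
  off at x_n, with c chosen so that h is orthogonal to all U_e. Solving f'' + conj(z) f = h
  backwards from zero data at x_n gives, by Green's formula, f'(0) = 0, so f lies in the
  domain of the Hamiltonian; testing v against f shows that h is orthogonal to v, hence h = 0.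
*)

theory Submission
  imports Defs
begin

text \<open>The limiting recurrence links only indices of equal parity, and its sign is immaterial
  because only norms are estimated. The perturbation couples the two parities, so neighbouring
  weights must be comparable as well: besides making the gaps decreasing, log-convexity has to
  supply a lower bound for \<open>\<alpha> (Suc k) / \<alpha> k\<close>. Square-summability of the
  gaps also acts twice: the errors in the expansions of sine and cosine are of second order in the
  gaps, and |u_k|^2 <= M d_(k+1) turns the squared norm into a sum of d_k^2. The derivative at a
  node can be as large as |u_k|/d_k and gets no bound of its own; on each cell the solution is
  controlled by its values at the two ends.

  In the kernel argument the cut-off is forced: test functions must have compact support. Zero data
  at x_n achieve this but leave no freedom at 0, so the Neumann condition has to come from
  orthogonality. These are p conditions for the p parameters of U_c, solvable because the Gram
  matrix is invertible. The conjugate of z enters through the second slot of the inner product. All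
  this works for every nonzero z, hence for i and -i at once.\<close>

section \<open>Absolutely continuous functions\<close>

text \<open>Unlike \<^const>\<open>ac_deriv\<close>, this fixes the values of \<open>F\<close> at both end points.\<close>

definition ac_on :: "real \<Rightarrow> real \<Rightarrow> (real \<Rightarrow> 'a::euclidean_space) \<Rightarrow> (real \<Rightarrow> 'a) \<Rightarrow> bool"
  where "ac_on a b F f \<longleftrightarrow> f absolutely_integrable_on {a..b} \<and>
    (\<forall>t\<in>{a..b}. F t = F a + integral {a..t} f)"

lemma ac_on_absolutely_integrable: "ac_on a b F f \<Longrightarrow> f absolutely_integrable_on {a..b}"
  by (simp add: ac_on_def)

lemma ac_on_eq: "ac_on a b F f \<Longrightarrow> t \<in> {a..b} \<Longrightarrow> F t = F a + integral {a..t} f"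
  unfolding ac_on_def by blast

lemma ac_onI:
  assumes "f absolutely_integrable_on {a..b}"
    and "\<And>t. t \<in> {a..b} \<Longrightarrow> F t = F a + integral {a..t} f"
  shows "ac_on a b F f"
  using assms unfolding ac_on_def by blast

lemma ac_on_integral: "ac_on a b F f \<Longrightarrow> t \<in> {a..b} \<Longrightarrow> integral {a..t} f = F t - F a"
  by (metis ac_on_eq add_diff_cancel_left')

text \<open>The two end points form a null set, so a density known only on the open interval is
  enough.\<close>

lemma ac_on_cong:
  assumes "ac_on a b F f" "\<And>t. t \<in> {a..b} \<Longrightarrow> F t = G t"
    and "\<And>t. t \<in> {a<..<b} \<Longrightarrow> f t = g t"
  shows "ac_on a b G g"
proof (cases "a \<le> b")
  case True
  have neg: "negligible {a, b}" by simp
  have eq: "g x = f x" if "x \<in> {a..b} - {a, b}" for x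
    using assms(3)[of x] that by auto
  have "g absolutely_integrable_on {a..b}"
    by (rule absolutely_integrable_spike[OF _ neg eq]) (use assms(1) in \<open>auto simp: ac_on_def\<close>)
  moreover have "integral {a..t} g = integral {a..t} f" if "t \<in> {a..b}" for t
    by (rule integral_spike[OF neg]) (use eq that in auto)
  moreover have "F t = F a + integral {a..t} f" if "t \<in> {a..b}" for t
    using ac_on_eq[OF assms(1) that] .
  ultimately show ?thesis
    using assms(2) True by (intro ac_onI) (metis atLeastAtMost_iff order_refl)+
qed (simp add: ac_on_def)

lemma ac_on_continuous:
  assumes "ac_on a b F f"
  shows "continuous_on {a..b} F"
proof -
  have "f integrable_on {a..b}"
    using ac_on_absolutely_integrable[OF assms] by (simp add: absolutely_integrable_on_def)
  then have "continuous_on {a..b} (\<lambda>t. F a + integral {a..t} f)"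
    by (intro continuous_intros indefinite_integral_continuous_1)
  then show ?thesis
    by (rule continuous_on_eq) (rule ac_on_eq[OF assms, symmetric])
qed

lemma ac_on_C1:
  fixes F :: "real \<Rightarrow> 'a::euclidean_space"
  assumes "\<And>t. (F has_vector_derivative f t) (at t)" "continuous_on {a..b} f"
  shows "ac_on a b F f"
proof -
  have "f absolutely_integrable_on {a..b}"
    using assms(2) by (rule absolutely_integrable_continuous_real)
  moreover have "F t = F a + integral {a..t} f" if "t \<in> {a..b}" for t
  proof -
    have "(f has_integral F t - F a) {a..t}"
      by (rule fundamental_theorem_of_calculus)
        (use that in \<open>auto intro!: has_vector_derivative_at_within[OF assms(1)]\<close>)
    then show ?thesis by (simp add: integral_unique)
  qed
  ultimately show ?thesis by (rule ac_onI)
qed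

lemma ac_on_integrable_upto:
  "ac_on a b F f \<Longrightarrow> t \<in> {a..b} \<Longrightarrow> f integrable_on {a..t}"
  by (rule integrable_on_subinterval[of f "{a..b}"])
    (auto dest: ac_on_absolutely_integrable simp: absolutely_integrable_on_def)

lemma ac_on_add:
  assumes "ac_on a b F f" "ac_on a b G g"
  shows "ac_on a b (\<lambda>t. F t + G t) (\<lambda>t. f t + g t)"
proof -
  have "integral {a..t} (\<lambda>t. f t + g t) = integral {a..t} f + integral {a..t} g"
    if "t \<in> {a..b}" for t
    by (rule Henstock_Kurzweil_Integration.integral_add)
      (rule ac_on_integrable_upto[OF assms(1) that] ac_on_integrable_upto[OF assms(2) that])+
  then have "F t + G t = F a + G a + integral {a..t} (\<lambda>t. f t + g t)" if "t \<in> {a..b}" for t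
    using that by (simp add: ac_on_integral[OF assms(1) that] ac_on_integral[OF assms(2) that])
  then show ?thesis
    using set_integral_add(1)[OF assms[THEN ac_on_absolutely_integrable]] by (intro ac_onI)
qed

lemma ac_on_linear:
  assumes "bounded_linear L" "ac_on a b F f"
  shows "ac_on a b (\<lambda>t. L (F t)) (\<lambda>t. L (f t))"
proof -
  interpret L: bounded_linear L by fact
  have "integral {a..t} (\<lambda>t. L (f t)) = L (integral {a..t} f)" if "t \<in> {a..b}" for t
    using integral_linear[OF ac_on_integrable_upto[OF assms(2) that] assms(1)] by (simp add: o_def)
  then have "L (F t) = L (F a) + integral {a..t} (\<lambda>t. L (f t))" if "t \<in> {a..b}" for t
    using that by (simp add: ac_on_integral[OF assms(2) that] L.diff)
  then show ?thesis
    using absolutely_integrable_linear[OF ac_on_absolutely_integrable[OF assms(2)] assms(1)]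
    unfolding o_def by (rule ac_onI[rotated])
qed

lemma ac_on_const: "ac_on a b (\<lambda>t. c) (\<lambda>t. 0)"
  by (rule ac_on_C1) auto

lemma ac_on_indefinite_integral:
  assumes "f absolutely_integrable_on {a..b}"
  shows "ac_on a b (\<lambda>t. integral {a..t} f) f"
  using assms by (intro ac_onI) auto

text \<open>Integration by parts from Fubini's theorem alone, with no pointwise differentiation of
  the merely integrable \<open>f\<close> and \<open>g\<close>. A general bilinear \<open>B\<close>
  serves both the scalar multiplication in variation of constants and the inner product in Green's
  formula.\<close>

lemma integral_bilinear_indefinite:
  fixes f :: "real \<Rightarrow> 'a::euclidean_space" and g :: "real \<Rightarrow> 'b::euclidean_space"
    and B :: "'a \<Rightarrow> 'b \<Rightarrow> 'c::euclidean_space"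
  assumes "bounded_bilinear B"
    and f: "f absolutely_integrable_on {a..b}" and g: "g absolutely_integrable_on {a..b}"
    and "a \<le> b"
  defines "F \<equiv> \<lambda>t. integral {a..t} f" and "G \<equiv> \<lambda>t. integral {a..t} g"
  shows "(\<lambda>t. B (f t) (G t)) absolutely_integrable_on {a..b}"
    and "(\<lambda>t. B (F t) (g t)) absolutely_integrable_on {a..b}"
    and "B (F b) (G b) = integral {a..b} (\<lambda>t. B (f t) (G t) + B (F t) (g t))"
proof -
  interpret B: bounded_bilinear B by fact
  define M where "M = lebesgue_on {a..b}"
  interpret M: finite_measure M
    unfolding M_def by (rule finite_measure_lebesgue_on) simp
  interpret P: pair_sigma_finite M M ..
  have fM: "integrable M f" and gM: "integrable M g"
    using f g by (auto simp: M_def intro: absolutely_integrable_imp_integrable)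
  have [measurable]: "f \<in> borel_measurable M" "g \<in> borel_measurable M"
    using fM gM by auto
  have Bmeas: "(\<lambda>p. B (u p) (v p)) \<in> borel_measurable N"
    if [measurable]: "u \<in> borel_measurable N" "v \<in> borel_measurable N"
    for N :: "'n measure" and u v
  proof -
    have "(\<lambda>q. B (fst q) (snd q)) \<in> borel_measurable borel"
      by (intro borel_measurable_continuous_onI B.continuous_on continuous_intros)
    from measurable_compose[OF _ this, of "\<lambda>p. (u p, v p)" N] show ?thesis by simp
  qed
  have id[measurable]: "(\<lambda>x. x) \<in> borel_measurable M"
    unfolding M_def by (intro measurable_restrict_space1 measurable_completion) simp
  obtain K where K: "\<And>x y. norm (B x y) \<le> norm x * norm y * K" "K \<ge> 0"
    using B.nonneg_bounded by blast
  \<comment> \<open>Split the square \<open>[a,b]\<^sup>2\<close> along its diagonal and integrate each triangle in the order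
    that produces an indefinite integral.\<close>
  let ?ind = "\<lambda>s r. if r \<le> s then 1 else (0::real)"
  have int: "integrable (M \<Otimes>\<^sub>M M) (\<lambda>(s, r). B (f s) (g r))"
  proof (rule P.Fubini_integrable)
    show m: "(\<lambda>(s, r). B (f s) (g r)) \<in> borel_measurable (M \<Otimes>\<^sub>M M)"
      unfolding split_def by (rule Bmeas) auto
    have inn: "integrable M (\<lambda>r. B (f s) (g r))" for s
      by (rule integrable_bounded_linear[OF B.bounded_linear_right gM])
    then show "AE s in M. integrable M (\<lambda>r. case (s, r) of (s, r) \<Rightarrow> B (f s) (g r))"
      by simp
    show "integrable M (\<lambda>s. \<integral>r. norm (case (s, r) of (s, r) \<Rightarrow> B (f s) (g r)) \<partial>M)"
    proof (rule Bochner_Integration.integrable_bound)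
      show "integrable M (\<lambda>s. norm (f s) * (K * (\<integral>r. norm (g r) \<partial>M)))"
        using fM by auto
      show "(\<lambda>s. \<integral>r. norm (case (s, r) of (s, r) \<Rightarrow> B (f s) (g r)) \<partial>M) \<in> borel_measurable M"
        using m by measurable
      have "(\<integral>r. norm (B (f s) (g r)) \<partial>M) \<le> (\<integral>r. norm (f s) * K * norm (g r) \<partial>M)" for s
        by (rule integral_mono) (use inn gM K(1)[of "f s" "g _"] in \<open>auto simp: mult_ac\<close>)
      then show "AE s in M. norm (\<integral>r. norm (case (s, r) of (s, r) \<Rightarrow> B (f s) (g r)) \<partial>M)
          \<le> norm (norm (f s) * (K * (\<integral>r. norm (g r) \<partial>M)))"
        using K(2) by (auto simp: abs_mult mult_ac)
    qed
  qed
  have mi: "(\<lambda>(s, r). ?ind s r) \<in> borel_measurable (M \<Otimes>\<^sub>M M)"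
    unfolding split_def by measurable
  have int1: "integrable (M \<Otimes>\<^sub>M M) (\<lambda>(s, r). ?ind s r *\<^sub>R B (f s) (g r))"
  proof (rule Bochner_Integration.integrable_bound[OF int])
    show "(\<lambda>(s, r). ?ind s r *\<^sub>R B (f s) (g r)) \<in> borel_measurable (M \<Otimes>\<^sub>M M)"
      using borel_measurable_scaleR[OF mi borel_measurable_integrable[OF int]]
      by (simp add: split_def)
  qed auto
  have int2: "integrable (M \<Otimes>\<^sub>M M) (\<lambda>(s, r). (1 - ?ind s r) *\<^sub>R B (f s) (g r))"
  proof (rule Bochner_Integration.integrable_bound[OF int])
    show "(\<lambda>(s, r). (1 - ?ind s r) *\<^sub>R B (f s) (g r)) \<in> borel_measurable (M \<Otimes>\<^sub>M M)"
      using borel_measurable_scaleR[OF borel_measurable_diff[OF borel_measurable_const mi]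
          borel_measurable_integrable[OF int], of 1]
      by (simp add: split_def)
  qed auto
  have in1: "(\<integral>r. ?ind s r *\<^sub>R B (f s) (g r) \<partial>M) = B (f s) (G s)" if "s \<in> space M" for s
  proof -
    have gi: "integrable M (\<lambda>r. ?ind s r *\<^sub>R g r)"
      by (rule Bochner_Integration.integrable_bound[OF gM]) auto
    have "(\<integral>r. ?ind s r *\<^sub>R B (f s) (g r) \<partial>M) = (\<integral>r. B (f s) (?ind s r *\<^sub>R g r) \<partial>M)"
      by (simp add: B.scaleR_right)
    also have "\<dots> = B (f s) (\<integral>r. ?ind s r *\<^sub>R g r \<partial>M)"
      by (rule integral_bounded_linear[OF B.bounded_linear_right gi])
    also have "(\<integral>r. ?ind s r *\<^sub>R g r \<partial>M) = integral {a..b} (\<lambda>r. if r \<in> {..s} then g r else 0)"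
      using gi unfolding M_def
      by (subst lebesgue_integral_eq_integral) (auto intro!: integral_cong)
    also have "\<dots> = G s"
      using that unfolding integral_restrict_Int G_def M_def
      by (intro arg_cong[where f = "\<lambda>A. integral A g"]) auto
    finally show ?thesis .
  qed
  \<comment> \<open>The diagonal was assigned to the other triangle, so the range here is
    \<open>{a..<r}\<close>; the missing point is negligible.\<close>
  have in2: "(\<integral>s. (1 - ?ind s r) *\<^sub>R B (f s) (g r) \<partial>M) = B (F r) (g r)" if "r \<in> space M" for r
  proof -
    have fi: "integrable M (\<lambda>s. (1 - ?ind s r) *\<^sub>R f s)"
      by (rule Bochner_Integration.integrable_bound[OF fM]) auto
    have "(\<integral>s. (1 - ?ind s r) *\<^sub>R B (f s) (g r) \<partial>M) = (\<integral>s. B ((1 - ?ind s r) *\<^sub>R f s) (g r) \<partial>M)"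
      by (simp add: B.scaleR_left)
    also have "\<dots> = B (\<integral>s. (1 - ?ind s r) *\<^sub>R f s \<partial>M) (g r)"
      by (rule integral_bounded_linear[OF B.bounded_linear_left fi])
    also have "(\<integral>s. (1 - ?ind s r) *\<^sub>R f s \<partial>M) = integral {a..b} (\<lambda>s. if s \<in> {..<r} then f s else 0)"
      using fi unfolding M_def
      by (subst lebesgue_integral_eq_integral) (auto intro!: integral_cong)
    also have "\<dots> = integral {a..<r} f"
      using that unfolding integral_restrict_Int M_def
      by (intro arg_cong[where f = "\<lambda>A. integral A f"]) auto
    also have "\<dots> = F r"
      unfolding F_def
      by (rule integral_subset_negligible) (auto intro: negligible_subset[of "{r}"])
    finally show ?thesis .
  qed
  have I1: "integrable M (\<lambda>s. B (f s) (G s))"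
    using P.integrable_fst[OF int1] Bochner_Integration.integrable_cong[OF refl in1, of M "\<lambda>x. x"]
    by simp
  have I2: "integrable M (\<lambda>s. B (F s) (g s))"
    using P.integrable_snd[OF int2] Bochner_Integration.integrable_cong[OF refl in2, of M "\<lambda>x. x"]
    by simp
  show "(\<lambda>t. B (f t) (G t)) absolutely_integrable_on {a..b}"
    "(\<lambda>t. B (F t) (g t)) absolutely_integrable_on {a..b}"
    using I1 I2 unfolding M_def by (auto simp: integrable_restrict_space set_integrable_def)
  have "B (F b) (G b) = B (integral\<^sup>L M f) (integral\<^sup>L M g)"
    using fM gM by (simp add: F_def G_def M_def lebesgue_integral_eq_integral)
  also have "\<dots> = (\<integral>s. (\<integral>r. B (f s) (g r) \<partial>M) \<partial>M)"
    by (simp only: integral_bounded_linear[OF B.bounded_linear_right gM]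
      integral_bounded_linear[OF B.bounded_linear_left fM])
  also have "\<dots> = (\<integral>(s, r). B (f s) (g r) \<partial>(M \<Otimes>\<^sub>M M))"
    by (rule P.integral_fst[OF int])
  also have "\<dots> = (\<integral>p. (case p of (s, r) \<Rightarrow> ?ind s r *\<^sub>R B (f s) (g r)) +
      (case p of (s, r) \<Rightarrow> (1 - ?ind s r) *\<^sub>R B (f s) (g r)) \<partial>(M \<Otimes>\<^sub>M M))"
    by (intro Bochner_Integration.integral_cong) auto
  also have "\<dots> = (\<integral>(s, r). ?ind s r *\<^sub>R B (f s) (g r) \<partial>(M \<Otimes>\<^sub>M M)) +
      (\<integral>(s, r). (1 - ?ind s r) *\<^sub>R B (f s) (g r) \<partial>(M \<Otimes>\<^sub>M M))"
    by (rule Bochner_Integration.integral_add[OF int1 int2])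
  also have "\<dots> = (\<integral>s. (\<integral>r. ?ind s r *\<^sub>R B (f s) (g r) \<partial>M) \<partial>M) +
      (\<integral>r. (\<integral>s. (1 - ?ind s r) *\<^sub>R B (f s) (g r) \<partial>M) \<partial>M)"
    by (simp only: P.integral_fst[OF int1] P.integral_snd[OF int2])
  also have "\<dots> = (\<integral>s. B (f s) (G s) \<partial>M) + (\<integral>r. B (F r) (g r) \<partial>M)"
    by (intro arg_cong2[where f = "(+)"] Bochner_Integration.integral_cong refl in1 in2)
  also have "\<dots> = (\<integral>s. B (f s) (G s) + B (F s) (g s) \<partial>M)"
    using I1 I2 by simp
  also have "\<dots> = integral {a..b} (\<lambda>t. B (f t) (G t) + B (F t) (g t))"
    using I1 I2 unfolding M_def by (intro lebesgue_integral_eq_integral) auto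
  finally show "B (F b) (G b) = integral {a..b} (\<lambda>t. B (f t) (G t) + B (F t) (g t))" .
qed

text \<open>Expanding both factors about their initial values leaves a product of two indefinite
  integrals, two terms linear in one such integral, and a constant.\<close>

lemma ac_on_bilinear:
  fixes F f :: "real \<Rightarrow> 'a::euclidean_space" and G g :: "real \<Rightarrow> 'b::euclidean_space"
    and B :: "'a \<Rightarrow> 'b \<Rightarrow> 'c::euclidean_space"
  assumes B: "bounded_bilinear B" and F: "ac_on a b F f" and G: "ac_on a b G g" and "a \<le> b"
  shows "ac_on a b (\<lambda>t. B (F t) (G t)) (\<lambda>t. B (f t) (G t) + B (F t) (g t))"
proof -
  interpret B: bounded_bilinear B by fact
  define F0 where "F0 = (\<lambda>t. integral {a..t} f)"
  define G0 where "G0 = (\<lambda>t. integral {a..t} g)"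
  have f: "f absolutely_integrable_on {a..b}" and g: "g absolutely_integrable_on {a..b}"
    using F G by (auto dest: ac_on_absolutely_integrable)
  have sub: "f absolutely_integrable_on {a..t}" "g absolutely_integrable_on {a..t}"
    if "t \<in> {a..b}" for t
    using that by (auto intro!: absolutely_integrable_on_subinterval[OF f]
      absolutely_integrable_on_subinterval[OF g])
  have "ac_on a b (\<lambda>t. B (F0 t) (G0 t)) (\<lambda>t. B (f t) (G0 t) + B (F0 t) (g t))"
  proof (rule ac_onI)
    show "(\<lambda>t. B (f t) (G0 t) + B (F0 t) (g t)) absolutely_integrable_on {a..b}"
      using integral_bilinear_indefinite(1,2)[OF B f g \<open>a \<le> b\<close>]
      by (auto simp: F0_def G0_def intro: set_integral_add)
    show "B (F0 t) (G0 t) = B (F0 a) (G0 a) + integral {a..t} (\<lambda>t. B (f t) (G0 t) + B (F0 t) (g t))"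
      if "t \<in> {a..b}" for t
      using integral_bilinear_indefinite(3)[OF B sub[OF that]] that
      by (simp add: F0_def G0_def B.zero_left)
  qed
  note 1 = this
  have 2: "ac_on a b (\<lambda>t. B (F a) (G0 t)) (\<lambda>t. B (F a) (g t))"
    unfolding G0_def
    by (intro ac_on_linear[OF B.bounded_linear_right] ac_on_indefinite_integral g)
  have 3: "ac_on a b (\<lambda>t. B (F0 t) (G a)) (\<lambda>t. B (f t) (G a))"
    unfolding F0_def
    by (intro ac_on_linear[OF B.bounded_linear_left] ac_on_indefinite_integral f)
  have eq: "F t = F a + F0 t" "G t = G a + G0 t" if "t \<in> {a..b}" for t
    unfolding F0_def G0_def using ac_on_eq[OF F that] ac_on_eq[OF G that] .
  show ?thesis
  proof (rule ac_on_cong[OF ac_on_add[OF ac_on_add[OF 1 2] ac_on_add[OF 3 ac_on_const[of a b "B (F a) (G a)"]]]])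
    fix t assume t: "t \<in> {a..b}"
    show "B (F0 t) (G0 t) + B (F a) (G0 t) + (B (F0 t) (G a) + B (F a) (G a)) = B (F t) (G t)"
      unfolding eq[OF t] B.add_left B.add_right by (simp add: algebra_simps)
  next
    fix t assume "t \<in> {a<..<b}"
    then have t: "t \<in> {a..b}" by simp
    show "B (f t) (G0 t) + B (F0 t) (g t) + B (F a) (g t) + (B (f t) (G a) + 0) =
        B (f t) (G t) + B (F t) (g t)"
      unfolding eq[OF t] B.add_left B.add_right by (simp add: algebra_simps)
  qed
qed

section \<open>The equation u'' = -z u + h on one interval\<close>

lemma bounded_bilinear_scalar_mult:
  "bounded_bilinear ((*s) :: complex \<Rightarrow> complex ^ 'p \<Rightarrow> complex ^ 'p)"
  unfolding bilinear_conv_bounded_bilinear[symmetric] bilinear_def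
  by (auto intro!: linearI simp: vec_eq_iff algebra_simps)

lemma bounded_bilinear_vec_cinner:
  "bounded_bilinear (vec_cinner :: complex ^ 'p \<Rightarrow> complex ^ 'p \<Rightarrow> complex)"
  unfolding bilinear_conv_bounded_bilinear[symmetric] bilinear_def
  by (auto intro!: linearI
    simp: vec_cinner_def algebra_simps sum.distrib scaleR_sum_right sum_distrib_left)

interpretation smult: bounded_bilinear "(*s) :: complex \<Rightarrow> complex ^ 'p \<Rightarrow> complex ^ 'p"
  by (rule bounded_bilinear_scalar_mult)

interpretation vcinner: bounded_bilinear "vec_cinner :: complex ^ 'p \<Rightarrow> complex ^ 'p \<Rightarrow> complex"
  by (rule bounded_bilinear_vec_cinner)

lemma vec_cinner_scale_right: "vec_cinner v (c *s w) = cnj c * vec_cinner v w"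
  by (simp add: vec_cinner_def sum_distrib_left mult_ac)

lemma vec_cinner_hermitian:
  assumes "hermitian A"
  shows "vec_cinner (A *v v) w = vec_cinner v (A *v w)"
proof -
  have "vec_cinner (A *v v) w = (\<Sum>i\<in>UNIV. \<Sum>j\<in>UNIV. A $ i $ j * v $ j * cnj (w $ i))"
    by (simp add: vec_cinner_def matrix_vector_mult_def sum_distrib_right)
  also have "\<dots> = (\<Sum>j\<in>UNIV. \<Sum>i\<in>UNIV. A $ i $ j * v $ j * cnj (w $ i))"
    by (rule sum.swap)
  also have "\<dots> = (\<Sum>j\<in>UNIV. \<Sum>i\<in>UNIV. v $ j * cnj (A $ j $ i * w $ i))"
  proof (intro sum.cong refl)
    fix i j
    have "A $ i $ j = cnj (A $ j $ i)" using assms unfolding hermitian_def by blast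
    then show "A $ i $ j * v $ j * cnj (w $ i) = v $ j * cnj (A $ j $ i * w $ i)" by simp
  qed
  also have "\<dots> = vec_cinner v (A *v w)"
    by (simp add: vec_cinner_def matrix_vector_mult_def sum_distrib_left)
  finally show ?thesis .
qed

text \<open>Together with \<open>sinw\<close> this is the fundamental system of u'' = -z u with data
  (1, 0) and (0, 1) at 0. The branch of the root does not matter: cos w and (sin w)/w are even in
  w.\<close>

definition cosw :: "complex \<Rightarrow> real \<Rightarrow> complex"
  where "cosw z t = cos (csqrt z * of_real t)"

text \<open>Meaningful for \<open>z \<noteq> 0\<close> only: \<open>sinw 0 t\<close> is \<open>0\<close> instead of \<open>t\<close>.\<close>

definition sinw :: "complex \<Rightarrow> real \<Rightarrow> complex"
  where "sinw z t = sin (csqrt z * of_real t) / csqrt z"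

lemma cosw_0 [simp]: "cosw z 0 = 1" and sinw_0 [simp]: "sinw z 0 = 0"
  by (simp_all add: cosw_def sinw_def)

text \<open>The Wronskian of the fundamental system. It makes the transfer matrix invertible and
  reproduces the inhomogeneity in variation of constants.\<close>

lemma cosw_sinw_squared: "z \<noteq> 0 \<Longrightarrow> cosw z t * cosw z t + z * (sinw z t * sinw z t) = 1"
proof -
  assume "z \<noteq> 0"
  have "z * (sinw z t * sinw z t) = (csqrt z)\<^sup>2 * (sinw z t * sinw z t)" by simp
  also have "\<dots> = (sin (csqrt z * of_real t))\<^sup>2"
    using \<open>z \<noteq> 0\<close> by (simp add: sinw_def power2_eq_square del: power2_csqrt)
  finally show ?thesis by (simp add: cosw_def power2_eq_square[symmetric])
qed

lemma sinw_has_vector_derivative: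
  assumes "z \<noteq> 0"
  shows "((\<lambda>t. sinw z (t - a)) has_vector_derivative cosw z (t - a)) (at t within S)"
  using assms unfolding sinw_def cosw_def
  by (auto intro!: derivative_eq_intros has_vector_derivative_real_field)

lemma cosw_has_vector_derivative:
  assumes "z \<noteq> 0"
  shows "((\<lambda>t. cosw z (t - a)) has_vector_derivative - (z * sinw z (t - a))) (at t within S)"
proof -
  have "z / csqrt z = csqrt z"
    using assms by (metis csqrt_eq_0 nonzero_mult_div_cancel_left power2_csqrt power2_eq_square)
  then have "z * sinw z (t - a) = csqrt z * sin (csqrt z * of_real (t - a))"
    unfolding sinw_def by (metis times_divide_eq_left times_divide_eq_right mult.commute)
  then show ?thesis unfolding cosw_def
    by (auto intro!: derivative_eq_intros has_vector_derivative_real_field)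
qed

lemma continuous_on_cosw [continuous_intros]:
  "continuous_on S f \<Longrightarrow> continuous_on S (\<lambda>t. cosw z (f t))"
  for f :: "real \<Rightarrow> real"
  unfolding cosw_def by (intro continuous_intros)

lemma continuous_on_sinw [continuous_intros]:
  "continuous_on S f \<Longrightarrow> continuous_on S (\<lambda>t. sinw z (f t))"
  for f :: "real \<Rightarrow> real"
  unfolding sinw_def by (cases "z = 0") (auto intro!: continuous_intros)

lemma ac_on_cosw:
  "z \<noteq> 0 \<Longrightarrow> ac_on a b (\<lambda>t. cosw z (t - a)) (\<lambda>t. - (z * sinw z (t - a)))"
  by (intro ac_on_C1 cosw_has_vector_derivative continuous_intros)

lemma ac_on_sinw:
  "z \<noteq> 0 \<Longrightarrow> ac_on a b (\<lambda>t. sinw z (t - a)) (\<lambda>t. cosw z (t - a))"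
  by (intro ac_on_C1 sinw_has_vector_derivative continuous_intros)

text \<open>The condition \<open>t \<le> 1\<close> bounds the exponential factor of the complex
  Taylor remainder by its value at 1; dividing by the root of \<open>z\<close> lowers the cubic
  power of its modulus to a square.\<close>

lemma sinw_cosw_taylor:
  assumes "z \<noteq> 0"
  obtains K where "K \<ge> 0"
    and "\<And>t. 0 \<le> t \<Longrightarrow> t \<le> 1 \<Longrightarrow> norm (sinw z t - of_real t) \<le> K * t ^ 3"
    and "\<And>t. 0 \<le> t \<Longrightarrow> t \<le> 1 \<Longrightarrow> norm (cosw z t - 1) \<le> K * t\<^sup>2"
proof
  define w where "w = csqrt z"
  have w: "w \<noteq> 0" using assms by (simp add: w_def)
  let ?K = "exp \<bar>Im w\<bar> * (norm w)\<^sup>2"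
  show "?K \<ge> 0" by simp
  fix t :: real assume t: "0 \<le> t" "t \<le> 1"
  have e: "exp \<bar>Im (w * of_real t)\<bar> \<le> exp \<bar>Im w\<bar>"
    using t by (simp add: abs_mult mult_left_le)
  have "norm (sin (w * of_real t) - w * of_real t)
      \<le> exp \<bar>Im (w * of_real t)\<bar> * norm (w * of_real t) ^ 3 / 2"
    using Taylor_sin[of "w * of_real t" 2]
    by (simp add: numeral_2_eq_2 numeral_3_eq_3 sin_coeff_def)
  also have "\<dots> \<le> exp \<bar>Im w\<bar> * norm (w * of_real t) ^ 3 / 1"
    using e by (intro frac_le mult_right_mono) auto
  also have "\<dots> = norm w * (?K * t ^ 3)"
    using t by (simp add: norm_mult power_mult_distrib power2_eq_square power3_eq_cube mult_ac)
  finally have s: "norm (sin (w * of_real t) - w * of_real t) \<le> norm w * (?K * t ^ 3)" .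
  have "sinw z t - of_real t = (sin (w * of_real t) - w * of_real t) / w"
    using w by (simp add: sinw_def w_def field_simps)
  then show "norm (sinw z t - of_real t) \<le> ?K * t ^ 3"
    using s w by (simp add: norm_divide divide_le_eq mult.commute)
  have "norm (cos (w * of_real t) - 1)
      \<le> exp \<bar>Im (w * of_real t)\<bar> * norm (w * of_real t) ^ 2"
    using Taylor_cos[of "w * of_real t" 1]
    by (simp add: numeral_2_eq_2 cos_coeff_def)
  also have "\<dots> \<le> exp \<bar>Im w\<bar> * norm (w * of_real t) ^ 2"
    using e by (intro mult_right_mono) auto
  also have "\<dots> = ?K * t\<^sup>2"
    using t by (simp add: norm_mult power_mult_distrib mult_ac)
  finally show "norm (cosw z t - 1) \<le> ?K * t\<^sup>2"
    by (simp add: cosw_def w_def)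
qed

text \<open>The last three bounds feed the recurrence: quotients of \<open>sinw\<close> by gaps are
  off by a second-order factor, and the error of \<open>cosw z d / sinw z d\<close>, only of first
  order, is later multiplied by another \<open>sinw\<close>. The leading term 1/d is what the
  identity part of the hypothesis on \<Lambda> cancels.\<close>

lemma sinw_cosw_small:
  assumes "z \<noteq> 0"
  obtains K \<delta> where "K \<ge> 0" "\<delta> > 0"
    and "\<And>d. 0 < d \<Longrightarrow> d \<le> \<delta> \<Longrightarrow> sinw z d \<noteq> 0"
    and "\<And>d. 0 \<le> d \<Longrightarrow> d \<le> \<delta> \<Longrightarrow> norm (sinw z d) \<le> 2 * d"
    and "\<And>d. 0 \<le> d \<Longrightarrow> d \<le> \<delta> \<Longrightarrow> d / 2 \<le> norm (sinw z d)"
    and "\<And>d. 0 \<le> d \<Longrightarrow> d \<le> \<delta> \<Longrightarrow> norm (cosw z d) \<le> 2"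
    and "\<And>d. 0 < d \<Longrightarrow> d \<le> \<delta> \<Longrightarrow> norm (sinw z d) \<le> d * (1 + K * d\<^sup>2)"
    and "\<And>d. 0 < d \<Longrightarrow> d \<le> \<delta> \<Longrightarrow> d / norm (sinw z d) \<le> 1 + K * d\<^sup>2"
    and "\<And>d. 0 < d \<Longrightarrow> d \<le> \<delta> \<Longrightarrow> norm (cosw z d / sinw z d - 1 / of_real d) \<le> K * d"
proof -
  obtain K where K: "K \<ge> 0"
    and s: "\<And>t. 0 \<le> t \<Longrightarrow> t \<le> 1 \<Longrightarrow> norm (sinw z t - of_real t) \<le> K * t ^ 3"
    and c: "\<And>t. 0 \<le> t \<Longrightarrow> t \<le> 1 \<Longrightarrow> norm (cosw z t - 1) \<le> K * t\<^sup>2"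
    using sinw_cosw_taylor[OF assms] by blast
  \<comment> \<open>Chosen so that \<open>d \<le> 1\<close> and the relative error
    \<open>K * d^2\<close> is at most 1/2.\<close>
  define \<delta> where "\<delta> = 1 / (2 * (K + 1))"
  have \<delta>: "0 < \<delta>" "\<delta> \<le> 1" using K by (auto simp: \<delta>_def field_simps)
  have Kd: "K * d\<^sup>2 \<le> 1/2" if "0 \<le> d" "d \<le> \<delta>" for d
  proof -
    have "d\<^sup>2 \<le> d" using that \<delta> by (simp add: power2_eq_square mult_left_le)
    then have "K * d\<^sup>2 \<le> (K + 1) * \<delta>" using that K by (intro mult_mono) auto
    also have "(K + 1) * \<delta> = 1/2" using K by (simp add: \<delta>_def field_simps)
    finally show ?thesis .
  qed
  have s1: "norm (sinw z d - of_real d) \<le> d * (K * d\<^sup>2)" if "0 \<le> d" "d \<le> \<delta>" for d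
    using s[of d] that \<delta> by (simp add: power2_eq_square power3_eq_cube mult_ac)
  have s2: "norm (sinw z d - of_real d) \<le> d / 2" if "0 \<le> d" "d \<le> \<delta>" for d
    using s1[OF that] mult_left_mono[OF Kd[OF that] that(1)] by simp
  have low: "d / 2 \<le> norm (sinw z d)" if "0 \<le> d" "d \<le> \<delta>" for d
    using s2[OF that] norm_triangle_ineq2[of "of_real d" "sinw z d"] that
    by (simp add: norm_minus_commute)
  have up: "norm (sinw z d) \<le> d + norm (sinw z d - of_real d)" if "0 \<le> d" for d
    using norm_triangle_ineq2[of "sinw z d" "of_real d"] that by simp
  have nz: "sinw z d \<noteq> 0" if "0 < d" "d \<le> \<delta>" for d
    using low[of d] that by auto
  show thesis
  proof (rule that[of "4 * K" \<delta>])
    fix d :: real assume d: "0 \<le> d" "d \<le> \<delta>"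
    show "norm (sinw z d) \<le> 2 * d" using up[of d] s2[of d] d by simp
    have "norm (cosw z d) \<le> norm (cosw z d - 1) + 1"
      using norm_triangle_ineq2[of "cosw z d" 1] by simp
    then show "norm (cosw z d) \<le> 2" using c[of d] d \<delta> Kd[OF d] by simp
  next
    fix d :: real assume d: "0 < d" "d \<le> \<delta>"
    then have d0: "0 \<le> d" by simp
    have "d * (1 + K * d\<^sup>2) \<le> d * (1 + 4 * K * d\<^sup>2)" using d K by (intro mult_left_mono) auto
    moreover have "norm (sinw z d) \<le> d * (1 + K * d\<^sup>2)"
      using up[OF d0] s1[OF d0 d(2)] by (simp add: distrib_left)
    ultimately show "norm (sinw z d) \<le> d * (1 + 4 * K * d\<^sup>2)" by (rule order_trans[rotated])
    have "d - d * (K * d\<^sup>2) \<le> norm (sinw z d)"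
      using s1[OF d0 d(2)] norm_triangle_ineq2[of "of_real d" "sinw z d"] d
      by (simp add: norm_minus_commute)
    \<comment> \<open>A linear bound for 1/(1 - e) on [0, 1/2]; the constant \<open>4 * K\<close>
      comes from here and again from the quotient estimate below.\<close>
    moreover have "1 \<le> (1 - e) * (1 + 4 * e)" if "0 \<le> e" "e \<le> 1/2" for e :: real
    proof -
      have "0 \<le> e * (3 - 4 * e)" using that by simp
      then show ?thesis by (simp add: algebra_simps)
    qed
    note this[of "K * d\<^sup>2"]
    ultimately have "d * 1 \<le> d * ((1 - K * d\<^sup>2) * (1 + 4 * (K * d\<^sup>2)))"
      using d K Kd[OF d0 d(2)] by (intro mult_left_mono) auto
    also have "\<dots> = (d - d * (K * d\<^sup>2)) * (1 + 4 * K * d\<^sup>2)" by (simp add: algebra_simps)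
    also have "\<dots> \<le> norm (sinw z d) * (1 + 4 * K * d\<^sup>2)"
      using \<open>d - d * (K * d\<^sup>2) \<le> norm (sinw z d)\<close> K by (intro mult_right_mono) auto
    finally show "d / norm (sinw z d) \<le> 1 + 4 * K * d\<^sup>2"
      using nz[OF d] by (simp add: divide_le_eq mult.commute)
    have "cosw z d / sinw z d - 1 / of_real d =
        ((cosw z d - 1) * of_real d - (sinw z d - of_real d)) / (sinw z d * of_real d)"
      using nz[OF d] d by (simp add: field_simps)
    also have "norm \<dots> \<le> (2 * K * d ^ 3) / (d / 2 * d)"
      unfolding norm_divide
    proof (rule frac_le)
      have "norm ((cosw z d - 1) * of_real d - (sinw z d - of_real d))
          \<le> norm (cosw z d - 1) * d + norm (sinw z d - of_real d)"
        using norm_triangle_ineq4[of "(cosw z d - 1) * of_real d" "sinw z d - of_real d"] d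
        by (simp add: norm_mult)
      also have "\<dots> \<le> K * d\<^sup>2 * d + K * d ^ 3"
        using c[of d] s[of d] d \<delta> by (intro add_mono mult_right_mono) auto
      also have "\<dots> = 2 * K * d ^ 3" by (simp add: power2_eq_square power3_eq_cube)
      finally show "norm ((cosw z d - 1) * of_real d - (sinw z d - of_real d)) \<le> 2 * K * d ^ 3" .
      show "d / 2 * d \<le> norm (sinw z d * of_real d)"
        using low[OF d0 d(2)] d by (simp add: norm_mult)
    qed (use d K in auto)
    also have "\<dots> = 4 * K * d" using d by (simp add: power3_eq_cube)
    finally show "norm (cosw z d / sinw z d - 1 / of_real d) \<le> 4 * K * d" .
  next
    show "0 \<le> 4 * K" "0 < \<delta>" using K \<delta> by auto
  qed (rule nz low; assumption)+
qed

section \<open>Variation of constants\<close>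

text \<open>
  Variation of constants: the pair of value and derivative at \<open>t\<close> of the solution of
  \<open>u'' = -z u + h\<close> whose value and derivative at \<open>a\<close> are \<open>s\<close>.
\<close>

definition flow :: "complex \<Rightarrow> (real \<Rightarrow> complex ^ 'p) \<Rightarrow> real \<Rightarrow>
    (complex ^ 'p) \<times> (complex ^ 'p) \<Rightarrow> real \<Rightarrow> (complex ^ 'p) \<times> (complex ^ 'p)"
  where "flow z h a s t =
    (let p = fst s + integral {a..t} (\<lambda>r. - (sinw z (r - a) *s h r));
         q = snd s + integral {a..t} (\<lambda>r. cosw z (r - a) *s h r)
     in (cosw z (t - a) *s p + sinw z (t - a) *s q,
         cosw z (t - a) *s q + (- (z * sinw z (t - a))) *s p))"

lemma flow_start [simp]: "flow z h a s a = s"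
  by (simp add: flow_def)

lemma continuous_scalar_absolutely_integrable:
  fixes \<phi> :: "real \<Rightarrow> complex" and h :: "real \<Rightarrow> complex ^ 'p"
  assumes "continuous_on {a..b} \<phi>" "h absolutely_integrable_on {a..b}"
  shows "(\<lambda>t. \<phi> t *s h t) absolutely_integrable_on {a..b}"
proof (rule absolutely_integrable_bounded_measurable_product[where h = "(*s)"])
  show "bilinear ((*s) :: complex \<Rightarrow> complex ^ 'p \<Rightarrow> complex ^ 'p)"
    unfolding bilinear_conv_bounded_bilinear by (rule bounded_bilinear_scalar_mult)
  show "\<phi> \<in> borel_measurable (lebesgue_on {a..b})"
    using assms(1) by (simp add: continuous_imp_measurable_on_sets_lebesgue)
  show "bounded (\<phi> ` {a..b})"
    using assms(1) by (intro compact_imp_bounded compact_continuous_image) auto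
qed (use assms in auto)

text \<open>The densities of the two coefficients are chosen so that their contributions cancel in
  the first derivative and add up, by the Wronskian identity, to \<open>h\<close> in the
  second.\<close>

lemma flow_ac:
  assumes z: "z \<noteq> 0" and h: "h absolutely_integrable_on {a..b}" and ab: "a \<le> b"
  shows "ac_on a b (\<lambda>t. fst (flow z h a s t)) (\<lambda>t. snd (flow z h a s t))"
    and "ac_on a b (\<lambda>t. snd (flow z h a s t)) (\<lambda>t. - (z *s fst (flow z h a s t)) + h t)"
proof -
  define P where "P t = fst s + integral {a..t} (\<lambda>r. - (sinw z (r - a) *s h r))" for t
  define Q where "Q t = snd s + integral {a..t} (\<lambda>r. cosw z (r - a) *s h r)" for t
  have sh: "(\<lambda>r. - (sinw z (r - a) *s h r)) absolutely_integrable_on {a..b}"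
    using continuous_scalar_absolutely_integrable[OF _ h, of "\<lambda>r. - sinw z (r - a)"]
    by (simp add: continuous_intros)
  have ch: "(\<lambda>r. cosw z (r - a) *s h r) absolutely_integrable_on {a..b}"
    by (intro continuous_scalar_absolutely_integrable[OF _ h] continuous_intros)
  have P: "ac_on a b P (\<lambda>r. - (sinw z (r - a) *s h r))"
    using ac_on_add[OF ac_on_const[of a b "fst s"] ac_on_indefinite_integral[OF sh]]
    by (simp add: P_def[abs_def])
  have Q: "ac_on a b Q (\<lambda>r. cosw z (r - a) *s h r)"
    using ac_on_add[OF ac_on_const[of a b "snd s"] ac_on_indefinite_integral[OF ch]]
    by (simp add: Q_def[abs_def])
  note mult = ac_on_bilinear[OF bounded_bilinear_scalar_mult _ _ ab]
  have zs: "ac_on a b (\<lambda>t. - (z * sinw z (t - a))) (\<lambda>t. - (z * cosw z (t - a)))"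
    using ac_on_linear[OF bounded_linear_mult_right[of "- z"] ac_on_sinw[OF z]] by simp
  have f: "fst (flow z h a s t) = cosw z (t - a) *s P t + sinw z (t - a) *s Q t"
    and f': "snd (flow z h a s t) = cosw z (t - a) *s Q t + (- (z * sinw z (t - a))) *s P t" for t
    by (simp_all add: flow_def P_def Q_def Let_def)
  show "ac_on a b (\<lambda>t. fst (flow z h a s t)) (\<lambda>t. snd (flow z h a s t))"
    by (rule ac_on_cong[OF ac_on_add[OF mult[OF ac_on_cosw[OF z] P] mult[OF ac_on_sinw[OF z] Q]]])
      (simp_all add: f f' vec_eq_iff algebra_simps)
  show "ac_on a b (\<lambda>t. snd (flow z h a s t)) (\<lambda>t. - (z *s fst (flow z h a s t)) + h t)"
  proof (rule ac_on_cong[OF ac_on_add[OF mult[OF ac_on_cosw[OF z] Q] mult[OF zs P]]])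
    fix t assume "t \<in> {a<..<b}"
    let ?c = "cosw z (t - a)" and ?s = "sinw z (t - a)"
    have "?c * ?c * h t $ i + z * ?s * ?s * h t $ i = h t $ i" for i
      using arg_cong[OF cosw_sinw_squared[OF z], of "\<lambda>y. y * h t $ i" "t - a"]
      by (simp add: algebra_simps)
    then show "(- (z * ?s)) *s Q t + ?c *s (?c *s h t) +
        ((- (z * ?c)) *s P t + (- (z * ?s)) *s (- (?s *s h t))) =
        - (z *s fst (flow z h a s t)) + h t"
      unfolding f by (simp add: vec_eq_iff algebra_simps)
  qed (simp add: f')
qed

text \<open>The integrals of \<open>h\<close> do not involve \<open>s\<close>, so it suffices to
  invert the transfer matrix, which has determinant 1.\<close>

lemma flow_surj:
  assumes z: "z \<noteq> 0"
  shows "\<exists>s. flow z h a s t = y"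
proof -
  let ?c = "cosw z (t - a)" and ?s = "sinw z (t - a)"
  define p where "p = ?c *s fst y - ?s *s snd y"
  define q where "q = ?c *s snd y + (z * ?s) *s fst y"
  have "?c * ?c * v $ i + z * ?s * ?s * v $ i = v $ i" for v :: "complex ^ 'a" and i
    using arg_cong[OF cosw_sinw_squared[OF z], of "\<lambda>y. y * v $ i" "t - a"]
    by (simp add: algebra_simps)
  note sq = this[of "fst y"] this[of "snd y"]
  have "?c *s p + ?s *s q = fst y" "?c *s q + (- (z * ?s)) *s p = snd y"
    using sq by (simp_all add: vec_eq_iff p_def q_def algebra_simps)
  then have "flow z h a (p - integral {a..t} (\<lambda>r. - (sinw z (r - a) *s h r)),
      q - integral {a..t} (\<lambda>r. cosw z (r - a) *s h r)) t = y"
    by (simp add: flow_def Let_def prod_eq_iff)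
  then show ?thesis ..
qed

lemma flow_homogeneous:
  assumes "\<And>r. r \<in> {a..t} \<Longrightarrow> h r = 0"
  shows "flow z h a s t = (cosw z (t - a) *s fst s + sinw z (t - a) *s snd s,
     cosw z (t - a) *s snd s + (- (z * sinw z (t - a))) *s fst s)"
proof -
  have "integral {a..t} (\<lambda>r. - (sinw z (r - a) *s h r)) = integral {a..t} (\<lambda>r. 0)"
    "integral {a..t} (\<lambda>r. cosw z (r - a) *s h r) = integral {a..t} (\<lambda>r. 0)"
    by (intro integral_cong, simp add: assms)+
  then show ?thesis by (simp add: flow_def Let_def)
qed

section \<open>Solutions with point interactions\<close>

lemma right_lim_eq:
  assumes "continuous_on {a..b} F" "a < b" "\<And>t. t \<in> {a<..<b} \<Longrightarrow> f t = F t"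
  shows "right_lim f a = F a"
proof -
  have "(F \<longlongrightarrow> F a) (at_right a)"
    using assms(1,2) by (rule continuous_on_Icc_at_rightD)
  moreover have "\<forall>\<^sub>F t in at_right a. F t = f t"
    using eventually_at_right_real[OF assms(2)] by eventually_elim (simp add: assms(3))
  ultimately have "(f \<longlongrightarrow> F a) (at_right a)" by (rule Lim_transform_eventually)
  then show ?thesis
    unfolding right_lim_def by (rule tendsto_Lim[OF trivial_limit_at_right_real])
qed

lemma left_lim_eq:
  assumes "continuous_on {a..b} F" "a < b" "\<And>t. t \<in> {a<..<b} \<Longrightarrow> f t = F t"
  shows "left_lim f b = F b"
proof -
  have "(F \<longlongrightarrow> F b) (at_left b)"
    using assms(1,2) by (rule continuous_on_Icc_at_leftD)
  moreover have "\<forall>\<^sub>F t in at_left b. F t = f t"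
    using eventually_at_left_real[OF assms(2)] by eventually_elim (simp add: assms(3))
  ultimately have "(f \<longlongrightarrow> F b) (at_left b)" by (rule Lim_transform_eventually)
  then show ?thesis
    unfolding left_lim_def by (rule tendsto_Lim[OF trivial_limit_at_left_real])
qed

lemma ac_derivD:
  assumes "ac_deriv a b f g"
  obtains F where "ac_on a b F g" "\<And>t. t \<in> {a<..<b} \<Longrightarrow> f t = F t"
proof -
  obtain c where g: "g absolutely_integrable_on {a..b}"
    and c: "\<And>t. t \<in> {a<..<b} \<Longrightarrow> f t = c + integral {a..t} g"
    using assms unfolding ac_deriv_def absolutely_integrable_on_Icc_iff_Ioo by blast
  have "ac_on a b (\<lambda>t. c + integral {a..t} g) g"
    using ac_on_add[OF ac_on_const[of a b c] ac_on_indefinite_integral[OF g]] by simp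
  with c show thesis by (rule that[rotated])
qed

lemma ac_derivI:
  assumes "ac_on a b F g" "\<And>t. t \<in> {a<..<b} \<Longrightarrow> f t = F t"
  shows "ac_deriv a b f g"
  unfolding ac_deriv_def absolutely_integrable_on_Icc_iff_Ioo[symmetric]
proof (intro conjI exI ballI)
  show "g absolutely_integrable_on {a..b}" using assms(1) by (rule ac_on_absolutely_integrable)
  show "f t = F a + integral {a..t} g" if t: "t \<in> {a<..<b}" for t
    using ac_on_eq[OF assms(1), of t] assms(2)[OF t] t by simp
qed

text \<open>Trades one-sided limits for end point values of continuous representatives, to which the
  product rule applies.\<close>

lemma W22_derivsD:
  assumes "W22_derivs a b f f' f''" "a < b"
  obtains F F' where "ac_on a b F F'" "ac_on a b F' f''"
    and "\<And>t. t \<in> {a<..<b} \<Longrightarrow> f t = F t" "\<And>t. t \<in> {a<..<b} \<Longrightarrow> f' t = F' t"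
    and "right_lim f a = F a" "left_lim f b = F b"
    and "right_lim f' a = F' a" "left_lim f' b = F' b"
proof -
  have 1: "ac_deriv a b f f'" and 2: "ac_deriv a b f' f''"
    using assms(1) by (auto simp: W22_derivs_def)
  obtain F where F: "ac_on a b F f'" "\<And>t. t \<in> {a<..<b} \<Longrightarrow> f t = F t"
    using ac_derivD[OF 1] by metis
  obtain F' where F': "ac_on a b F' f''" "\<And>t. t \<in> {a<..<b} \<Longrightarrow> f' t = F' t"
    using ac_derivD[OF 2] by metis
  \<comment> \<open>The density \<open>f'\<close> may be replaced by its representative, as both
    agree on the open interval.\<close>
  have "ac_on a b F F'"
    by (rule ac_on_cong[OF F(1)]) (auto simp: F'(2))
  then show thesis using F'(1) F(2) F'(2)
  proof (rule that)
    show "right_lim f a = F a"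
      by (rule right_lim_eq[OF ac_on_continuous[OF F(1)] assms(2) F(2)])
    show "left_lim f b = F b"
      by (rule left_lim_eq[OF ac_on_continuous[OF F(1)] assms(2) F(2)])
    show "right_lim f' a = F' a"
      by (rule right_lim_eq[OF ac_on_continuous[OF F'(1)] assms(2) F'(2)])
    show "left_lim f' b = F' b"
      by (rule left_lim_eq[OF ac_on_continuous[OF F'(1)] assms(2) F'(2)])
  qed
qed

lemma W22_derivsI:
  assumes F: "ac_on a b F F'" and F': "ac_on a b F' f''"
    and eq: "\<And>t. t \<in> {a<..<b} \<Longrightarrow> f t = F t" "\<And>t. t \<in> {a<..<b} \<Longrightarrow> f' t = F' t"
    and "square_integrable (lebesgue_on {a<..<b}) f''"
  shows "W22_derivs a b f f' f''"
  unfolding W22_derivs_def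
proof (intro conjI)
  have "ac_on a b F f'" by (rule ac_on_cong[OF F]) (auto simp: eq)
  then show "ac_deriv a b f f'" using eq(1) by (rule ac_derivI)
  show "ac_deriv a b f' f''" using F' eq(2) by (rule ac_derivI)
qed fact

section \<open>The sesquilinear Wronskian and Green's formula on one interval\<close>

definition boundary_form :: "complex ^ 'p \<Rightarrow> complex ^ 'p \<Rightarrow> complex ^ 'p \<Rightarrow> complex ^ 'p \<Rightarrow> complex"
  where "boundary_form u u' v v' = vec_cinner u' v - vec_cinner u v'"

lemma lagrange_interval:
  assumes f: "W22_derivs a b f f' f''" and g: "W22_derivs a b g g' g''" and ab: "a < b"
  shows "((\<lambda>t. vec_cinner (f'' t) (g t) - vec_cinner (f t) (g'' t)) has_integral
      boundary_form (left_lim f b) (left_lim f' b) (left_lim g b) (left_lim g' b)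
      - boundary_form (right_lim f a) (right_lim f' a) (right_lim g a) (right_lim g' a)) {a..b}"
proof -
  obtain F F' where F: "ac_on a b F F'" "ac_on a b F' f''"
    and eF: "\<And>t. t \<in> {a<..<b} \<Longrightarrow> f t = F t"
    and lF: "right_lim f a = F a" "left_lim f b = F b" "right_lim f' a = F' a" "left_lim f' b = F' b"
    using W22_derivsD[OF f ab] by metis
  obtain G G' where G: "ac_on a b G G'" "ac_on a b G' g''"
    and eG: "\<And>t. t \<in> {a<..<b} \<Longrightarrow> g t = G t"
    and lG: "right_lim g a = G a" "left_lim g b = G b" "right_lim g' a = G' a" "left_lim g' b = G' b"
    using W22_derivsD[OF g ab] by metis
  note mult = ac_on_bilinear[OF bounded_bilinear_vec_cinner _ _ less_imp_le[OF ab]]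
  define W where "W t = boundary_form (F t) (F' t) (G t) (G' t)" for t
  have "ac_on a b W (\<lambda>t. vec_cinner (f'' t) (g t) - vec_cinner (f t) (g'' t))"
    using ac_on_add[OF mult[OF F(2) G(1)] ac_on_linear[OF bounded_linear_minus[OF bounded_linear_ident] mult[OF F(1) G(2)]]]
    by (rule ac_on_cong) (auto simp: W_def boundary_form_def eF eG)
  note W = this
  have "((\<lambda>t. vec_cinner (f'' t) (g t) - vec_cinner (f t) (g'' t)) has_integral (W b - W a)) {a..b}"
    using ac_on_integrable_upto[OF W, of b] ac_on_integral[OF W, of b] ab
    by (simp add: has_integral_iff)
  then show ?thesis by (simp add: W_def lF lG)
qed

section \<open>Local integrability\<close>

lemma square_integrable_mono_space:
  assumes "square_integrable (lebesgue_on T) f" "S \<subseteq> T" "S \<in> sets lebesgue" "T \<in> sets lebesgue"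
  shows "square_integrable (lebesgue_on S) f"
proof -
  have S: "S \<in> sets (lebesgue_on T)"
    using assms by (simp add: sets_restrict_space_iff)
  have eq: "lebesgue_on S = restrict_space (lebesgue_on T) S"
    using assms by (subst restrict_restrict_space) (auto simp: Int_absorb1)
  have "integrable (restrict_space (lebesgue_on T) S) (\<lambda>t. (norm (f t))\<^sup>2)"
    using assms(1) S unfolding square_integrable_def
    using integrable_mult_indicator[OF S, of "\<lambda>t. (norm (f t))\<^sup>2"]
    by (subst integrable_restrict_space) auto
  moreover have "f \<in> borel_measurable (restrict_space (lebesgue_on T) S)"
    using assms(1) unfolding square_integrable_def by (auto intro: measurable_restrict_space1)
  ultimately show ?thesis by (simp add: square_integrable_def eq)
qed

lemma square_integrable_imp_absolutely_integrable:
  fixes h :: "real \<Rightarrow> complex ^ 'p"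
  assumes "square_integrable halfline h" "0 \<le> a"
  shows "h absolutely_integrable_on {a..b}"
proof -
  have "square_integrable (lebesgue_on {a<..<b}) h"
    by (rule square_integrable_mono_space[OF assms(1)]) (use assms(2) in auto)
  then have m: "h \<in> borel_measurable (lebesgue_on {a<..<b})"
    and i: "integrable (lebesgue_on {a<..<b}) (\<lambda>t. (norm (h t))\<^sup>2)"
    by (auto simp: square_integrable_def)
  interpret finite_measure "lebesgue_on {a<..<b}"
    by (rule finite_measure_lebesgue_on) simp
  have "integrable (lebesgue_on {a<..<b}) h"
  proof (rule Bochner_Integration.integrable_bound)
    show "integrable (lebesgue_on {a<..<b}) (\<lambda>t. 1 + (norm (h t))\<^sup>2)"
      using i by auto
    have "norm (h t) \<le> 1 + (norm (h t))\<^sup>2" for t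
      using sum_squares_bound[of 1 "norm (h t)"] norm_ge_zero[of "h t"]
      by (simp del: norm_ge_zero)
    then show "AE t in lebesgue_on {a<..<b}. norm (h t) \<le> norm (1 + (norm (h t))\<^sup>2)"
      by simp
  qed (rule m)
  then have "h absolutely_integrable_on {a<..<b}"
    by (simp add: integrable_restrict_space set_integrable_def)
  then show ?thesis by (simp add: absolutely_integrable_on_Icc_iff_Ioo)
qed

lemma square_integrable_continuous:
  fixes F :: "real \<Rightarrow> complex ^ 'p"
  assumes F: "continuous_on {a..b} F" and eq: "\<And>t. t \<in> {a<..<b} \<Longrightarrow> f t = F t"
  shows "square_integrable (lebesgue_on {a<..<b}) f"
proof -
  have F': "continuous_on {a<..<b} F" by (rule continuous_on_subset[OF F]) auto
  have "(\<lambda>t. (norm (F t))\<^sup>2) absolutely_integrable_on {a..b}"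
    by (intro absolutely_integrable_continuous_real continuous_intros F)
  then have "integrable (lebesgue_on {a<..<b}) (\<lambda>t. (norm (F t))\<^sup>2)"
    unfolding absolutely_integrable_on_Icc_iff_Ioo
    by (rule absolutely_integrable_imp_integrable) simp
  then have "integrable (lebesgue_on {a<..<b}) (\<lambda>t. (norm (f t))\<^sup>2)"
    by (rule Bochner_Integration.integrable_cong[OF refl, THEN iffD1, rotated]) (simp add: eq)
  moreover have "F \<in> borel_measurable (lebesgue_on {a<..<b})"
    using F' by (intro continuous_imp_measurable_on_sets_lebesgue) auto
  then have "f \<in> borel_measurable (lebesgue_on {a<..<b})"
    by (rule measurable_cong[THEN iffD1, rotated]) (simp add: eq)
  ultimately show ?thesis by (simp add: square_integrable_def)
qed

section \<open>Solutions glued along the half-line\<close>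

locale point_interactions =
  fixes x :: "nat \<Rightarrow> real" and \<Lambda> :: "nat \<Rightarrow> complex ^ ('p::finite) ^ 'p"
  assumes strict_mono_x: "strict_mono x" and x_0 [simp]: "x 0 = 0"
    and x_at_top: "filterlim x at_top sequentially"
    and hermitian_\<Lambda>: "\<And>k. k \<ge> 1 \<Longrightarrow> hermitian (\<Lambda> k)"
begin

lemma x_less: "k < l \<Longrightarrow> x k < x l"
  using strict_mono_x by (rule strict_monoD)

lemma x_Suc_less [simp]: "x k < x (Suc k)"
  by (rule x_less) simp

lemma x_le_Suc [simp]: "x k \<le> x (Suc k)"
  using x_Suc_less[of k] by (rule less_imp_le)

lemma x_mono: "k \<le> l \<Longrightarrow> x k \<le> x l"
  using strict_mono_x by (simp add: strict_mono_less_eq)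

lemma x_nonneg [simp]: "0 \<le> x k"
  using x_mono[of 0 k] by simp

definition cell :: "real \<Rightarrow> nat" where "cell t = (LEAST k. t < x (Suc k))"

lemma cell_eq: "x k \<le> t \<Longrightarrow> t < x (Suc k) \<Longrightarrow> cell t = k"
  unfolding cell_def
proof (rule Least_equality)
  fix l assume "x k \<le> t" "t < x (Suc l)"
  then have "x k < x (Suc l)" by simp
  then show "k \<le> l" using strict_mono_x by (simp add: strict_mono_less)
qed

lemma cell_bounds:
  assumes "0 \<le> t"
  shows "x (cell t) \<le> t" "t < x (Suc (cell t))"
proof -
  have "\<forall>\<^sub>F k in sequentially. t + 1 \<le> x k"
    using x_at_top by (simp add: filterlim_at_top)
  then obtain K where "t < x (Suc K)"
    unfolding eventually_sequentially by (metis le_SucI less_add_one order_less_le_trans order_refl)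
  then show "t < x (Suc (cell t))" unfolding cell_def by (rule LeastI)
  show "x (cell t) \<le> t"
  proof (cases "cell t")
    case (Suc k)
    then have "\<not> t < x (Suc k)" unfolding cell_def by (metis lessI not_less_Least)
    then show ?thesis by (simp add: Suc)
  qed (use assms in simp)
qed

lemma cells_cover: "{0<..} \<subseteq> (\<Union>k. {x k..<x (Suc k)})"
proof
  fix t :: real assume "t \<in> {0<..}"
  then show "t \<in> (\<Union>k. {x k..<x (Suc k)})"
    using cell_bounds[of t] by (intro UN_I[of "cell t"]) auto
qed

text \<open>
  \<open>state z h s k\<close> is the value and the derivative at \<open>x k +\<close>, the jump at \<open>x k\<close> included, of
  the solution that starts with \<open>s\<close> at \<open>0\<close>.
\<close>

primrec state :: "complex \<Rightarrow> (real \<Rightarrow> complex ^ 'p) \<Rightarrow> (complex ^ 'p) \<times> (complex ^ 'p) \<Rightarrow>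
    nat \<Rightarrow> (complex ^ 'p) \<times> (complex ^ 'p)"
  where
    "state z h s 0 = s"
  | "state z h s (Suc k) = (let y = flow z h (x k) (state z h s k) (x (Suc k))
       in (fst y, snd y + \<Lambda> (Suc k) *v fst y))"

definition sol_pair :: "complex \<Rightarrow> (real \<Rightarrow> complex ^ 'p) \<Rightarrow> (complex ^ 'p) \<times> (complex ^ 'p) \<Rightarrow>
    real \<Rightarrow> (complex ^ 'p) \<times> (complex ^ 'p)"
  where "sol_pair z h s t = flow z h (x (cell t)) (state z h s (cell t)) t"

definition sol where "sol z h s t = fst (sol_pair z h s t)"
definition dsol where "dsol z h s t = snd (sol_pair z h s t)"

lemma sol_cell:
  assumes "x k \<le> t" "t < x (Suc k)"
  shows "sol z h s t = fst (flow z h (x k) (state z h s k) t)"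
    and "dsol z h s t = snd (flow z h (x k) (state z h s k) t)"
  using cell_eq[OF assms] by (simp_all add: sol_def dsol_def sol_pair_def)

text \<open>The local conditions on the domain, without the Neumann condition, compact support or
  global square-integrability. This admits homogeneous solutions, and test functions whose
  derivative at 0 is still to be determined.\<close>

definition admissible :: "(real \<Rightarrow> complex ^ 'p) \<Rightarrow> (real \<Rightarrow> complex ^ 'p) \<Rightarrow>
    (real \<Rightarrow> complex ^ 'p) \<Rightarrow> bool"
  where "admissible f f' f'' \<longleftrightarrow> (\<forall>k\<ge>1. W22_derivs (x (k - 1)) (x k) f f' f'') \<and>
      (\<forall>k\<ge>1. right_lim f (x k) = left_lim f (x k) \<and>
        right_lim f' (x k) - left_lim f' (x k) = \<Lambda> k *v right_lim f (x k))"

lemma admissible_W22: "admissible f f' f'' \<Longrightarrow> W22_derivs (x k) (x (Suc k)) f f' f''"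
  unfolding admissible_def by (metis One_nat_def diff_Suc_1 le_add1 plus_1_eq_Suc)

lemma admissible_jump:
  assumes "admissible f f' f''"
  shows "right_lim f (x (Suc k)) = left_lim f (x (Suc k))"
    and "right_lim f' (x (Suc k)) = left_lim f' (x (Suc k)) + \<Lambda> (Suc k) *v left_lim f (x (Suc k))"
  using assms unfolding admissible_def by (auto simp: diff_eq_eq add.commute)

lemma admissibleI:
  assumes "\<And>k. W22_derivs (x k) (x (Suc k)) f f' f''"
    and "\<And>k. right_lim f (x (Suc k)) = left_lim f (x (Suc k))"
    and "\<And>k. right_lim f' (x (Suc k)) = left_lim f' (x (Suc k)) + \<Lambda> (Suc k) *v left_lim f (x (Suc k))"
  shows "admissible f f' f''"
  unfolding admissible_def
proof (intro conjI allI impI)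
  fix k :: nat assume "1 \<le> k"
  then obtain l where k: "k = Suc l" by (cases k) auto
  show "W22_derivs (x (k - 1)) (x k) f f' f''" "right_lim f (x k) = left_lim f (x k)"
    "right_lim f' (x k) - left_lim f' (x k) = \<Lambda> k *v right_lim f (x k)"
    using assms[of l] by (simp_all add: k)
qed

lemma sol_right_lim:
  assumes z: "z \<noteq> 0" and h: "square_integrable halfline h"
  shows "right_lim (sol z h s) (x k) = fst (state z h s k)"
    and "right_lim (dsol z h s) (x k) = snd (state z h s k)"
proof -
  note ac = flow_ac[OF z square_integrable_imp_absolutely_integrable[OF h x_nonneg] less_imp_le[OF x_Suc_less]]
  show "right_lim (sol z h s) (x k) = fst (state z h s k)"
    using right_lim_eq[OF ac_on_continuous[OF ac(1)] x_Suc_less, of k "sol z h s" "state z h s k"]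
    by (simp add: sol_cell)
  show "right_lim (dsol z h s) (x k) = snd (state z h s k)"
    using right_lim_eq[OF ac_on_continuous[OF ac(2)] x_Suc_less, of k "dsol z h s" "state z h s k"]
    by (simp add: sol_cell)
qed

lemma sol_left_lim:
  assumes z: "z \<noteq> 0" and h: "square_integrable halfline h"
  shows "left_lim (sol z h s) (x (Suc k)) = fst (flow z h (x k) (state z h s k) (x (Suc k)))"
    and "left_lim (dsol z h s) (x (Suc k)) = snd (flow z h (x k) (state z h s k) (x (Suc k)))"
proof -
  note ac = flow_ac[OF z square_integrable_imp_absolutely_integrable[OF h x_nonneg] less_imp_le[OF x_Suc_less]]
  show "left_lim (sol z h s) (x (Suc k)) = fst (flow z h (x k) (state z h s k) (x (Suc k)))"
    using left_lim_eq[OF ac_on_continuous[OF ac(1)] x_Suc_less, of k "sol z h s" "state z h s k"]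
    by (simp add: sol_cell)
  show "left_lim (dsol z h s) (x (Suc k)) = snd (flow z h (x k) (state z h s k) (x (Suc k)))"
    using left_lim_eq[OF ac_on_continuous[OF ac(2)] x_Suc_less, of k "dsol z h s" "state z h s k"]
    by (simp add: sol_cell)
qed

lemma sol_admissible:
  assumes z: "z \<noteq> 0" and h: "square_integrable halfline h"
  shows "admissible (sol z h s) (dsol z h s) (\<lambda>t. - (z *s sol z h s t) + h t)"
proof (rule admissibleI)
  fix k
  let ?a = "x k" and ?b = "x (Suc k)" and ?y = "state z h s k"
  note ac = flow_ac[OF z square_integrable_imp_absolutely_integrable[OF h x_nonneg]
      less_imp_le[OF x_Suc_less], of k ?y]
  have eq: "sol z h s t = fst (flow z h ?a ?y t)" "dsol z h s t = snd (flow z h ?a ?y t)"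
    if "t \<in> {?a<..<?b}" for t
    using that by (simp_all add: sol_cell)
  show "W22_derivs ?a ?b (sol z h s) (dsol z h s) (\<lambda>t. - (z *s sol z h s t) + h t)"
  proof (rule W22_derivsI[OF ac(1) _ eq])
    show "ac_on ?a ?b (\<lambda>t. snd (flow z h ?a ?y t)) (\<lambda>t. - (z *s sol z h s t) + h t)"
      by (rule ac_on_cong[OF ac(2)]) (auto simp: eq)
    have "square_integrable (lebesgue_on {?a<..<?b}) (sol z h s)"
      by (rule square_integrable_continuous[OF ac_on_continuous[OF ac(1)] eq(1)])
    moreover have "square_integrable (lebesgue_on {?a<..<?b}) h"
      by (rule square_integrable_mono_space[OF h]) (auto intro: order_le_less_trans[OF x_nonneg])
    ultimately show "square_integrable (lebesgue_on {?a<..<?b}) (\<lambda>t. - (z *s sol z h s t) + h t)"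
      using square_integrable_add[OF square_integrable_scale[of _ _ "- z"]] by simp
  qed
  show "right_lim (sol z h s) ?b = left_lim (sol z h s) ?b"
    "right_lim (dsol z h s) ?b = left_lim (dsol z h s) ?b + \<Lambda> (Suc k) *v left_lim (sol z h s) ?b"
    unfolding sol_left_lim[OF z h] sol_right_lim[OF z h] by (simp_all add: Let_def)
qed

section \<open>Green's formula across the interactions\<close>

definition form_at where
  "form_at f f' g g' k = boundary_form (right_lim f (x k)) (right_lim f' (x k))
     (right_lim g (x k)) (right_lim g' (x k))"

text \<open>A Hermitian jump changes both terms of the boundary form by the same amount, so the
  contributions of neighbouring cells telescope.\<close>

lemma lagrange_upto:
  assumes f: "admissible f f' f''" and g: "admissible g g' g''"
  shows "((\<lambda>t. vec_cinner (f'' t) (g t) - vec_cinner (f t) (g'' t)) has_integral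
      form_at f f' g g' n - form_at f f' g g' 0) {0..x n}"
proof (induction n)
  case 0
  show ?case by (simp add: has_integral_refl)
next
  case (Suc n)
  let ?b = "x (Suc n)"
  have "boundary_form (left_lim f ?b) (left_lim f' ?b) (left_lim g ?b) (left_lim g' ?b) =
      form_at f f' g g' (Suc n)"
    unfolding form_at_def admissible_jump[OF f] admissible_jump[OF g] boundary_form_def
    by (simp add: vcinner.add_left vcinner.add_right vec_cinner_hermitian hermitian_\<Lambda>)
  then have "((\<lambda>t. vec_cinner (f'' t) (g t) - vec_cinner (f t) (g'' t)) has_integral
      form_at f f' g g' (Suc n) - form_at f f' g g' n) {x n..?b}"
    using lagrange_interval[OF admissible_W22[OF f] admissible_W22[OF g] x_Suc_less, of n]
    by (simp add: form_at_def)
  from has_integral_combine[OF x_nonneg less_imp_le[OF x_Suc_less] Suc this] show ?case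
    by simp
qed

text \<open>Links the gauge integrals over finitely many cells with the Lebesgue integral over the
  half-line, by dominated convergence.\<close>

lemma LIMSEQ_integral_upto:
  fixes \<phi> :: "real \<Rightarrow> 'b::euclidean_space"
  assumes "integrable halfline \<phi>"
  shows "(\<lambda>n. integral {0..x n} \<phi>) \<longlonglongrightarrow> integral\<^sup>L halfline \<phi>"
proof -
  have m: "(\<lambda>t. if t \<in> {..x n} then \<phi> t else 0) \<in> borel_measurable halfline" for n
    using assms by (intro measurable_If_set) (auto simp: sets_restrict_space_iff)
  have i: "integrable halfline (\<lambda>t. if t \<in> {..x n} then \<phi> t else 0)" for n
    by (rule Bochner_Integration.integrable_bound[OF assms m]) auto
  have "integral\<^sup>L halfline (\<lambda>t. if t \<in> {..x n} then \<phi> t else 0) = integral {0..x n} \<phi>" for n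
  proof -
    have "integral\<^sup>L halfline (\<lambda>t. if t \<in> {..x n} then \<phi> t else 0)
        = integral ({..x n} \<inter> {0<..}) \<phi>"
      unfolding integral_restrict_Int[symmetric] by (rule lebesgue_integral_eq_integral[OF i]) simp
    also have "\<dots> = integral {0..x n} \<phi>"
      by (rule integral_subset_negligible) (auto intro: negligible_subset[of "{0}"])
    finally show ?thesis .
  qed
  moreover have "(\<lambda>n. integral\<^sup>L halfline (\<lambda>t. if t \<in> {..x n} then \<phi> t else 0))
      \<longlonglongrightarrow> integral\<^sup>L halfline \<phi>"
  proof (rule integral_dominated_convergence)
    show "integrable halfline (\<lambda>t. norm (\<phi> t))" using assms by simp
    have "(\<lambda>n. if t \<in> {..x n} then \<phi> t else 0) \<longlonglongrightarrow> \<phi> t" for t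
    proof (rule tendsto_eventually)
      have "\<forall>\<^sub>F n in sequentially. t \<le> x n" using x_at_top by (simp add: filterlim_at_top)
      then show "\<forall>\<^sub>F n in sequentially. (if t \<in> {..x n} then \<phi> t else 0) = \<phi> t"
        by eventually_elim simp
    qed
    then show "AE t in halfline. (\<lambda>n. if t \<in> {..x n} then \<phi> t else 0) \<longlonglongrightarrow> \<phi> t"
      by simp
  qed (use assms m in auto)
  ultimately show ?thesis by (simp only:)
qed

text \<open>\<open>f'\<close> is tied to \<open>f\<close> only through an integral. Its
  representative is continuous, so its value at the node is the one-sided derivative there of a
  function that vanishes on the cell.\<close>

lemma right_lim_zero_beyond:
  assumes f: "admissible f f' f''" and R: "\<And>t. t > R \<Longrightarrow> f t = 0" and "R < x k"
  shows "right_lim f (x k) = 0" "right_lim f' (x k) = 0"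
proof -
  let ?a = "x k" and ?b = "x (Suc k)"
  obtain F F' where F: "ac_on ?a ?b F F'" "ac_on ?a ?b F' f''"
    and eF: "\<And>t. t \<in> {?a<..<?b} \<Longrightarrow> f t = F t"
    and lF: "right_lim f ?a = F ?a" "right_lim f' ?a = F' ?a"
    using W22_derivsD[OF admissible_W22[OF f, of k] x_Suc_less] by metis
  have 0: "right_lim f ?a = 0"
    by (rule right_lim_eq[of ?a ?b "\<lambda>_. 0", OF _ x_Suc_less]) (use assms in auto)
  have "F t = 0" if "t \<in> {?a..<?b}" for t
  proof (cases "t = ?a")
    case False
    then show ?thesis using that eF[of t] R[of t] assms(3) by auto
  qed (use 0 lF in simp)
  then have "((\<lambda>t. 0) has_vector_derivative F' ?a) (at ?a within {?a..<?b})"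
  proof -
    have "((\<lambda>t. integral {?a..t} F') has_vector_derivative F' ?a) (at ?a within {?a..?b})"
      by (rule integral_has_vector_derivative) (use ac_on_continuous[OF F(2)] in simp_all)
    then have "((\<lambda>t. integral {?a..t} F') has_vector_derivative F' ?a) (at ?a within {?a..<?b})"
      by (rule has_vector_derivative_within_subset) auto
    then show ?thesis
    proof (rule has_vector_derivative_transform[rotated 2])
      fix t assume t: "t \<in> {?a..<?b}"
      show "0 = integral {?a..t} F'"
        using \<open>\<And>t. t \<in> {?a..<?b} \<Longrightarrow> F t = 0\<close>[OF t] lF 0 ac_on_eq[OF F(1), of t] t by simp
    qed simp
  qed
  moreover have "((\<lambda>t. 0::complex ^ 'p) has_vector_derivative 0) (at ?a within {?a..<?b})"
    by simp
  ultimately have "F' ?a = 0"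
    by (rule vector_derivative_unique_within[rotated])
      (simp add: trivial_limit_within)
  with 0 lF show "right_lim f (x k) = 0" "right_lim f' (x k) = 0" by simp_all
qed

text \<open>The compact support of \<open>f\<close> removes the boundary form at far nodes, so
  \<open>g\<close> needs no pointwise decay and may be a homogeneous solution.\<close>

lemma lagrange_halfline:
  assumes f: "admissible f f' f''" and g: "admissible g g' g''"
    and sq: "square_integrable halfline f" "square_integrable halfline f''"
      "square_integrable halfline g" "square_integrable halfline g''"
    and R: "\<And>t. t > R \<Longrightarrow> f t = 0"
  shows "integral\<^sup>L halfline (\<lambda>t. vec_cinner (f'' t) (g t)) -
      integral\<^sup>L halfline (\<lambda>t. vec_cinner (f t) (g'' t)) =
    - boundary_form (right_lim f 0) (right_lim f' 0) (right_lim g 0) (right_lim g' 0)"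
proof -
  let ?\<phi> = "\<lambda>t. vec_cinner (f'' t) (g t) - vec_cinner (f t) (g'' t)"
  note i = integrable_vec_cinner[OF sq(2,3)] integrable_vec_cinner[OF sq(1,4)]
  have "\<forall>\<^sub>F n in sequentially. R + 1 \<le> x n" using x_at_top by (simp add: filterlim_at_top)
  then have "\<forall>\<^sub>F n in sequentially. integral {0..x n} ?\<phi> = - form_at f f' g g' 0"
  proof eventually_elim
    case (elim n)
    then have "R < x n" by simp
    then have "right_lim f (x n) = 0" "right_lim f' (x n) = 0"
      by (auto intro: right_lim_zero_beyond[OF f R])
    then have "form_at f f' g g' n = 0"
      by (simp add: form_at_def boundary_form_def vcinner.zero_left)
    then show ?case using integral_unique[OF lagrange_upto[OF f g, of n]] by simp
  qed
  then have "(\<lambda>n. integral {0..x n} ?\<phi>) \<longlonglongrightarrow> - form_at f f' g g' 0"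
    by (rule tendsto_eventually)
  moreover have "(\<lambda>n. integral {0..x n} ?\<phi>) \<longlonglongrightarrow> integral\<^sup>L halfline ?\<phi>"
    using i by (intro LIMSEQ_integral_upto) auto
  ultimately have "integral\<^sup>L halfline ?\<phi> = - form_at f f' g g' 0"
    by (rule LIMSEQ_unique[rotated])
  then show ?thesis using i by (simp add: form_at_def)
qed

end

section \<open>Growth of the homogeneous solutions\<close>

text \<open>A discrete Gronwall argument: the maximum of two consecutive terms grows by at most the
  factor 1 + c_k <= exp c_k per step, with summable c_k.\<close>

lemma perturbed_recurrence_bounded:
  fixes y a b :: "nat \<Rightarrow> real"
  assumes y: "\<And>k. 0 \<le> y k" and a: "\<And>k. 0 \<le> a k" and b: "\<And>k. 0 \<le> b k"
    and sum: "summable a" "summable b"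
    and rec: "\<And>k. k \<ge> N \<Longrightarrow> y (k + 2) \<le> (1 + a k) * y k + b k * y (k + 1)"
  shows "\<exists>M\<ge>0. \<forall>k. y k \<le> M"
proof -
  define c where "c k = a k + b k" for k
  define m where "m k = max (y k) (y (Suc k))" for k
  have c: "0 \<le> c k" for k using a b by (simp add: c_def)
  have sc: "summable c" unfolding c_def[abs_def] using sum by (rule summable_add)
  have m0: "0 \<le> m k" for k using y by (simp add: m_def max_def)
  have step: "m (Suc k) \<le> (1 + c k) * m k" if "k \<ge> N" for k
  proof -
    have "y (k + 2) \<le> (1 + a k) * m k + b k * m k"
      using rec[OF that] a[of k] b[of k]
      by (smt (verit) Suc_eq_plus1 m_def max.cobounded1 max.cobounded2 mult_left_mono)
    moreover have "y (Suc k) \<le> (1 + c k) * m k"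
      using mult_right_mono[of 1 "1 + c k" "m k"] c m0 by (simp add: m_def)
    ultimately show ?thesis by (simp add: m_def c_def algebra_simps)
  qed
  have bnd: "m (N + j) \<le> m N * exp (\<Sum>i<j. c (N + i))" for j
  proof (induction j)
    case (Suc j)
    have "m (N + Suc j) \<le> (1 + c (N + j)) * m (N + j)" using step[of "N + j"] by simp
    also have "\<dots> \<le> exp (c (N + j)) * (m N * exp (\<Sum>i<j. c (N + i)))"
      using Suc m0 c exp_ge_add_one_self[of "c (N + j)"] by (intro mult_mono) auto
    finally show ?case by (simp add: exp_add mult_ac)
  qed simp
  \<comment> \<open>The added sum covers the indices below \<open>N\<close>, where the recurrence is
    not assumed.\<close>
  define M where "M = m N * exp (suminf (\<lambda>i. c (N + i))) + (\<Sum>k<N. y k)"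
  have sN: "summable (\<lambda>i. c (N + i))" using sc by (simp add: summable_iff_shift add.commute)
  have "y k \<le> M" for k
  proof (cases "k < N")
    case True
    then have "y k \<le> (\<Sum>k<N. y k)" using y by (intro member_le_sum) auto
    moreover have "0 \<le> m N * exp (suminf (\<lambda>i. c (N + i)))" using m0 by simp
    ultimately show ?thesis unfolding M_def by linarith
  next
    case False
    then obtain j where k: "k = N + j" by (metis le_iff_add not_less)
    have "y k \<le> m (N + j)" by (simp add: k m_def)
    also have "\<dots> \<le> m N * exp (\<Sum>i<j. c (N + i))" by (rule bnd)
    also have "\<dots> \<le> m N * exp (suminf (\<lambda>i. c (N + i)))"
      using sum_le_suminf[OF sN, of "{..<j}"] c m0 by (intro mult_left_mono) auto
    also have "\<dots> \<le> M" unfolding M_def using y by (simp add: sum_nonneg)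
    finally show ?thesis .
  qed
  moreover have "0 \<le> M" using calculation y order_trans by blast
  ultimately show ?thesis by blast
qed

section \<open>Square-summable log-convex sequences\<close>

context
  fixes e :: "nat \<Rightarrow> real"
  assumes e_pos: "\<And>k. 0 < e k" and e_sq: "summable (\<lambda>k. (e k)\<^sup>2)"
    and e_convex: "\<And>k. (e (Suc k))\<^sup>2 \<le> e k * e (Suc (Suc k))"
begin

lemma summable_squares_LIMSEQ_zero: "e \<longlonglongrightarrow> 0"
  using summable_LIMSEQ_zero[OF e_sq] by (simp add: tendsto_null_power)

lemma log_convex_ratio_mono: "e (Suc k) / e k \<le> e (Suc (Suc k)) / e (Suc k)"
  using e_convex[of k] e_pos[of k] e_pos[of "Suc k"] by (simp add: field_simps power2_eq_square)

text \<open>Consecutive ratios increase, so one strict increase would persist forever and contradict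
  convergence to 0.\<close>

lemma log_convex_null_decreasing: "e (Suc k) \<le> e k"
proof (rule ccontr)
  assume "\<not> e (Suc k) \<le> e k"
  then have *: "e k < e (Suc k)" by simp
  have inc: "e (k + j) < e (Suc (k + j))" for j
  proof (induction j)
    case (Suc j)
    then have "1 < e (Suc (k + j)) / e (k + j)" using e_pos by (simp add: field_simps)
    also have "\<dots> \<le> e (Suc (Suc (k + j))) / e (Suc (k + j))" by (rule log_convex_ratio_mono)
    finally show ?case using e_pos[of "Suc (k + j)"] by (simp add: field_simps)
  qed (use * in simp)
  have "e k \<le> e (k + j)" for j
    by (induction j) (use inc in \<open>auto intro: order_trans less_imp_le\<close>)
  then have "e k \<le> 0"
    using LIMSEQ_ignore_initial_segment[OF summable_squares_LIMSEQ_zero, of k]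
    by (intro LIMSEQ_le_const[where X = "\<lambda>j. e (j + k)"]) (auto simp: add.commute)
  then show False using e_pos[of k] by simp
qed

text \<open>The weights solve the unperturbed recurrence up to sign. The product of two neighbouring
  ratios \<open>r k\<close> is \<open>e (Suc k) / e k\<close>, which increases with k; cancelling
  the common factor from two successive products gives \<open>r k \<le> r (Suc (Suc k))\<close>.
  Since \<alpha>_k^2 equals \<open>e k / r k\<close>, a lower bound on the ratios is an upper bound
  on the weights.\<close>

lemma log_convex_weights:
  obtains \<alpha> :: "nat \<Rightarrow> real" and \<rho> :: real
  where "\<rho> > 0" "\<And>k. \<alpha> k > 0" "\<And>k. \<alpha> (Suc (Suc k)) * e k = \<alpha> k * e (Suc k)"
    and "\<And>k. \<rho> * (\<alpha> k)\<^sup>2 \<le> e k" "\<And>k. \<rho> * \<alpha> k \<le> \<alpha> (Suc k)"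
proof -
  \<comment> \<open>The two-step recurrence is run on pairs of consecutive weights.\<close>
  define ab where "ab = rec_nat (1, e 0) (\<lambda>k p. (snd p, fst p * e (Suc k) / e k))"
  define \<alpha> where "\<alpha> k = fst (ab k)" for k
  have \<alpha>_Suc: "\<alpha> (Suc k) = snd (ab k)" for k by (simp add: \<alpha>_def ab_def)
  have \<alpha>0: "\<alpha> 0 = 1" "\<alpha> (Suc 0) = e 0" by (simp_all add: \<alpha>_def ab_def)
  have rec: "\<alpha> (Suc (Suc k)) = \<alpha> k * e (Suc k) / e k" for k
    unfolding \<alpha>_Suc[of "Suc k"] by (simp add: \<alpha>_def ab_def)
  have pos: "\<alpha> k > 0 \<and> \<alpha> (Suc k) > 0" for k
    by (induction k) (auto simp: \<alpha>0 rec e_pos)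
  \<comment> \<open>The recurrence determines the weights up to the choice of \<open>\<alpha> (Suc 0)\<close>, made for this identity.\<close>
  have prod: "\<alpha> k * \<alpha> (Suc k) = e k" for k
  proof (induction k)
    case (Suc k)
    have "\<alpha> (Suc k) * \<alpha> (Suc (Suc k)) = (\<alpha> k * \<alpha> (Suc k)) * e (Suc k) / e k"
      by (simp add: rec)
    then show ?case using Suc e_pos[of k] by simp
  qed (simp add: \<alpha>0)
  define r where "r k = \<alpha> (Suc k) / \<alpha> k" for k
  have rpos: "r k > 0" for k using pos by (simp add: r_def)
  have rr: "r (Suc k) * r k = e (Suc k) / e k" for k
    using pos[of k] e_pos[of k] by (simp add: r_def rec)
  have "r k \<le> r (Suc (Suc k))" for k
  proof -
    have "r k * r (Suc k) \<le> r (Suc (Suc k)) * r (Suc k)"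
      using log_convex_ratio_mono[of k] rr[of k] rr[of "Suc k"] by (simp add: mult.commute)
    then show ?thesis using rpos[of "Suc k"] by simp
  qed
  note rmono = this
  \<comment> \<open>One initial ratio for each parity.\<close>
  define \<rho> where "\<rho> = min (r 0) (r (Suc 0))"
  have "\<rho> \<le> r k \<and> \<rho> \<le> r (Suc k)" for k
    by (induction k) (use rmono in \<open>auto simp: \<rho>_def intro: order_trans\<close>)
  then have "\<rho> \<le> r k" for k by blast
  then have low: "\<rho> * \<alpha> k \<le> \<alpha> (Suc k)" for k
    using pos[of k] pos_le_divide_eq[of "\<alpha> k" \<rho> "\<alpha> (Suc k)"] by (simp add: r_def)
  show thesis
  proof (rule that[of \<rho> \<alpha>])
    show "\<rho> > 0" using rpos by (simp add: \<rho>_def)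
    show "\<alpha> (Suc (Suc k)) * e k = \<alpha> k * e (Suc k)" for k
      using e_pos[of k] by (simp add: rec)
    show "\<rho> * (\<alpha> k)\<^sup>2 \<le> e k" for k
      using mult_left_mono[OF low[of k], of "\<alpha> k"] pos[of k] prod[of k]
      by (simp add: power2_eq_square mult_ac)
  qed (use pos low in auto)
qed

end

lemma norm_matrix_vector_le: "norm (A *v v) \<le> matrix_opnorm A * norm v"
  unfolding matrix_opnorm_def by (rule onorm[OF matrix_vector_mul_bounded_linear])

lemma matrix_opnorm_nonneg: "0 \<le> matrix_opnorm A"
  unfolding matrix_opnorm_def by (rule onorm_pos_le[OF matrix_vector_mul_bounded_linear])

lemma scaleR_identity_matrix_vector: "(r *\<^sub>R mat 1) *v v = complex_of_real r *s v"
proof -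
  have "(\<Sum>j\<in>UNIV. (r *\<^sub>R (if i = j then 1 else 0)) * v $ j) = (\<Sum>j\<in>UNIV. if i = j then of_real r * v $ j else 0)" for i
    by (intro sum.cong) (auto simp: scaleR_conv_of_real)
  then show ?thesis
    by (simp add: vec_eq_iff matrix_vector_mult_def mat_def)
qed

section \<open>Cellwise integrability and the recurrence at the nodes\<close>

context point_interactions
begin

text \<open>Explicit bounds are needed on the tail only: each of the finitely many remaining cells
  is compact and carries a continuous function.\<close>

lemma square_integrable_cells:
  assumes F: "\<And>k. continuous_on {x k..x (Suc k)} (F k)"
    and f: "\<And>k t. x k \<le> t \<Longrightarrow> t < x (Suc k) \<Longrightarrow> f t = F k t"
    and B: "\<And>k t. k \<ge> N \<Longrightarrow> x k \<le> t \<Longrightarrow> t < x (Suc k) \<Longrightarrow> (norm (f t))\<^sup>2 \<le> B k"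
    and sum: "summable (\<lambda>k. B k * (x (Suc k) - x k))"
  shows "square_integrable halfline f"
proof -
  have "\<exists>C. \<forall>t\<in>{x k..x (Suc k)}. (norm (F k t))\<^sup>2 \<le> C" for k
  proof -
    have "compact ((\<lambda>t. (norm (F k t))\<^sup>2) ` {x k..x (Suc k)})"
      by (intro compact_continuous_image continuous_intros F) auto
    then have "bounded ((\<lambda>t. (norm (F k t))\<^sup>2) ` {x k..x (Suc k)})" by (rule compact_imp_bounded)
    then obtain C where "\<forall>y\<in>(\<lambda>t. (norm (F k t))\<^sup>2) ` {x k..x (Suc k)}. norm y \<le> C"
      unfolding bounded_iff by blast
    then show ?thesis by (intro exI[of _ C]) auto
  qed
  then obtain C where C: "\<And>k t. t \<in> {x k..x (Suc k)} \<Longrightarrow> (norm (F k t))\<^sup>2 \<le> C k" by metis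
  define D where "D k = (if k < N then C k else B k)" for k
  have D: "(norm (f t))\<^sup>2 \<le> D k" if "x k \<le> t" "t < x (Suc k)" for k t
    using C[of t k] B[of k t] f[OF that] that by (auto simp: D_def)
  have D0: "0 \<le> D k" for k using D[of k "x k"] order_trans[OF zero_le_power2] by simp
  have "\<forall>\<^sub>F k in sequentially. D k * (x (Suc k) - x k) = B k * (x (Suc k) - x k)"
    using eventually_ge_at_top[of N] by eventually_elim (simp add: D_def)
  from summable_cong[OF this] have sD: "summable (\<lambda>k. D k * (x (Suc k) - x k))" using sum by simp
  define A where "A k = {x k..<x (Suc k)} \<inter> {0<..}" for k
  have A: "A k \<in> sets halfline" for k by (simp add: A_def sets_restrict_space_iff)
  have UA: "(\<Union>k. A k) = {0<..}" using cells_cover by (auto simp: A_def)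
  have dA: "disjoint_family A"
    unfolding disjoint_family_on_def
  proof (intro ballI impI)
    fix m n :: nat assume "m \<noteq> n"
    show "A m \<inter> A n = {}"
    proof (rule ccontr)
      assume "A m \<inter> A n \<noteq> {}"
      then obtain t where "t \<in> A m" "t \<in> A n" by auto
      then have "cell t = m" "cell t = n" by (auto simp: A_def intro: cell_eq)
      then show False using \<open>m \<noteq> n\<close> by simp
    qed
  qed
  have m: "f \<in> borel_measurable halfline"
  proof (rule measurable_piecewise_restrict[of "range A"])
    fix \<Omega> assume "\<Omega> \<in> range A"
    then obtain k where k: "\<Omega> = A k" by auto
    then show "\<Omega> \<inter> space halfline \<in> sets halfline" using A[of k] by auto
    have "continuous_on (A k) (F k)" by (rule continuous_on_subset[OF F]) (auto simp: A_def)
    then have "F k \<in> borel_measurable (lebesgue_on (A k))"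
      by (intro continuous_imp_measurable_on_sets_lebesgue) (auto simp: A_def)
    then have "f \<in> borel_measurable (lebesgue_on (A k))"
      by (rule measurable_cong[THEN iffD1, rotated]) (auto simp: A_def f)
    moreover have "restrict_space halfline (A k) = lebesgue_on (A k)"
      by (subst restrict_restrict_space) (auto simp: A_def Int_absorb1 intro!: arg_cong[where f = "restrict_space lebesgue"])
    ultimately show "f \<in> borel_measurable (restrict_space halfline \<Omega>)" by (simp add: k)
  qed (use UA in auto)
  have "(\<integral>\<^sup>+t. ennreal ((norm (f t))\<^sup>2) \<partial>halfline) =
      (\<integral>\<^sup>+t\<in>(\<Union>k. A k). ennreal ((norm (f t))\<^sup>2) \<partial>halfline)"
    unfolding UA by (intro nn_integral_cong) auto
  also have "\<dots> = (\<Sum>k. \<integral>\<^sup>+t\<in>A k. ennreal ((norm (f t))\<^sup>2) \<partial>halfline)"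
    using m A dA by (intro nn_integral_disjoint_family) auto
  also have "\<dots> \<le> (\<Sum>k. ennreal (D k * (x (Suc k) - x k)))"
  proof (rule suminf_le)
    fix k
    have "(\<integral>\<^sup>+t\<in>A k. ennreal ((norm (f t))\<^sup>2) \<partial>halfline) \<le> (\<integral>\<^sup>+t\<in>A k. ennreal (D k) \<partial>halfline)"
      using D[of k] by (intro nn_integral_mono) (auto simp: A_def indicator_def intro!: ennreal_leI)
    also have "\<dots> = ennreal (D k) * emeasure halfline (A k)"
      using A by (rule nn_integral_cmult_indicator)
    also have "emeasure halfline (A k) = emeasure lebesgue (A k)"
      by (rule emeasure_restrict_space) (auto simp: A_def)
    also have "ennreal (D k) * \<dots> \<le> ennreal (D k) * emeasure lebesgue {x k..x (Suc k)}"
      by (intro mult_left_mono emeasure_mono) (auto simp: A_def)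
    also have "\<dots> = ennreal (D k * (x (Suc k) - x k))"
      using D0[of k] by (simp add: ennreal_mult)
    finally show "(\<integral>\<^sup>+t\<in>A k. ennreal ((norm (f t))\<^sup>2) \<partial>halfline) \<le> ennreal (D k * (x (Suc k) - x k))" .
  qed auto
  also have "\<dots> = ennreal (\<Sum>k. D k * (x (Suc k) - x k))"
    using D0 sD by (intro suminf_ennreal2) auto
  also have "\<dots> < \<infinity>" by simp
  finally have "integrable halfline (\<lambda>t. (norm (f t))\<^sup>2)"
    using m by (intro integrableI_bounded) auto
  then show ?thesis using m by (simp add: square_integrable_def)
qed

text \<open>Both one-sided derivatives at the middle node can be written in terms of values at
  neighbouring nodes; the one on the left comes from the Wronskian identity. Inserting it into the
  next transfer step eliminates the derivative.\<close>

lemma state_homogeneous_recurrence: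
  fixes s0 :: "(complex ^ 'p) \<times> (complex ^ 'p)"
  assumes z: "z \<noteq> 0"
  defines "u \<equiv> \<lambda>k. fst (state z (\<lambda>_. 0) s0 k)" and "e \<equiv> \<lambda>k. x (Suc k) - x k"
  assumes nz: "sinw z (e k) \<noteq> 0" "sinw z (e (Suc k)) \<noteq> 0"
  shows "u (Suc (Suc k)) = sinw z (e (Suc k)) *s
      (cosw z (e (Suc k)) / sinw z (e (Suc k)) *s u (Suc k) + cosw z (e k) / sinw z (e k) *s u (Suc k)
       + \<Lambda> (Suc k) *v u (Suc k) - 1 / sinw z (e k) *s u k)"
proof -
  let ?c = "cosw z (e k)" and ?s = "sinw z (e k)"
  let ?c' = "cosw z (e (Suc k))" and ?s' = "sinw z (e (Suc k))"
  let ?b = "snd (state z (\<lambda>_. 0) s0 k)"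
  have u1: "u (Suc k) = ?c *s u k + ?s *s ?b"
    by (simp add: u_def e_def Let_def flow_homogeneous)
  \<comment> \<open>The derivative at \<open>x (Suc k)\<close> from the left, before the
    jump.\<close>
  define q where "q = ?c *s ?b + (- (z * ?s)) *s u k"
  have u2: "u (Suc (Suc k)) = ?c' *s u (Suc k) + ?s' *s (q + \<Lambda> (Suc k) *v u (Suc k))"
    by (simp add: u_def e_def Let_def flow_homogeneous q_def)
  have "?s *s q = ?c *s u (Suc k) - u k"
  proof -
    have "?c * ?c * u k $ i + z * ?s * ?s * u k $ i = u k $ i" for i
      using arg_cong[OF cosw_sinw_squared[OF z], of "\<lambda>y. y * u k $ i" "e k"]
      by (simp add: algebra_simps)
    then show ?thesis unfolding u1 q_def by (simp add: vec_eq_iff algebra_simps)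
  qed
  then have q: "q = (1 / ?s) *s (?c *s u (Suc k) - u k)"
    using nz(1) by (metis divide_self_if times_divide_eq_left mult_1 vec.scale_one vec.scale_scale)
  show ?thesis
    unfolding u2 q using nz by (simp add: vec_eq_iff field_simps)
qed

end

section \<open>Growth under the summability hypotheses\<close>

locale summable_perturbation = point_interactions +
  assumes gap_sq: "summable (\<lambda>k. (x (Suc k) - x k)\<^sup>2)"
    and gap_convex: "\<And>k. (x (Suc (Suc k)) - x (Suc k))\<^sup>2
      \<le> (x (Suc k) - x k) * (x (Suc (Suc (Suc k))) - x (Suc (Suc k)))"
    and \<Lambda>_summable: "summable (\<lambda>k. (x (Suc (Suc k)) - x (Suc k)) * matrix_opnorm
      (\<Lambda> (Suc k) + (1 / (x (Suc k) - x k) + 1 / (x (Suc (Suc k)) - x (Suc k))) *\<^sub>R mat 1))"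
begin

text \<open>The paper's \<open>d\<^sub>k\<close> is \<open>e (k - 1)\<close>.\<close>

definition e :: "nat \<Rightarrow> real" where "e k = x (Suc k) - x k"

lemma e_pos: "0 < e k" by (simp add: e_def)

lemma e_sq: "summable (\<lambda>k. (e k)\<^sup>2)" using gap_sq by (simp add: e_def)

lemma e_convex: "(e (Suc k))\<^sup>2 \<le> e k * e (Suc (Suc k))" using gap_convex by (simp add: e_def)

definition excess :: "nat \<Rightarrow> real" where
  "excess k = matrix_opnorm (\<Lambda> (Suc k) + (1 / e k + 1 / e (Suc k)) *\<^sub>R mat 1)"

lemma excess_nonneg: "0 \<le> excess k"
  by (simp add: excess_def matrix_opnorm_nonneg)

lemma excess_summable: "summable (\<lambda>k. e (Suc k) * excess k)"
  using \<Lambda>_summable by (simp add: e_def excess_def)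

lemma state_growth:
  assumes z: "z \<noteq> 0"
  obtains M where "M \<ge> 0" "\<And>k. (norm (fst (state z (\<lambda>_. 0) s0 k)))\<^sup>2 \<le> M * e k"
proof -
  obtain K \<delta> where K: "K \<ge> 0" "\<delta> > 0"
    and nz: "\<And>d. 0 < d \<Longrightarrow> d \<le> \<delta> \<Longrightarrow> sinw z d \<noteq> 0"
    and s2: "\<And>d. 0 \<le> d \<Longrightarrow> d \<le> \<delta> \<Longrightarrow> norm (sinw z d) \<le> 2 * d"
    and sup: "\<And>d. 0 < d \<Longrightarrow> d \<le> \<delta> \<Longrightarrow> norm (sinw z d) \<le> d * (1 + K * d\<^sup>2)"
    and slow: "\<And>d. 0 < d \<Longrightarrow> d \<le> \<delta> \<Longrightarrow> d / norm (sinw z d) \<le> 1 + K * d\<^sup>2"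
    and cs: "\<And>d. 0 < d \<Longrightarrow> d \<le> \<delta> \<Longrightarrow> norm (cosw z d / sinw z d - 1 / of_real d) \<le> K * d"
  proof (rule sinw_cosw_small[OF z], goal_cases)
    case (1 K \<delta>)
    show ?thesis by (rule 1(1)[of K \<delta>]) (fact 1)+
  qed
  obtain \<alpha> \<rho> where \<rho>: "\<rho> > 0" and \<alpha>: "\<And>k. \<alpha> k > 0"
    and \<alpha>_rec: "\<And>k. \<alpha> (Suc (Suc k)) * e k = \<alpha> k * e (Suc k)"
    and \<alpha>_sq: "\<And>k. \<rho> * (\<alpha> k)\<^sup>2 \<le> e k" and \<alpha>_low: "\<And>k. \<rho> * \<alpha> k \<le> \<alpha> (Suc k)"
    using log_convex_weights[of e, OF e_pos e_sq e_convex] by metis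
  have dec: "e (Suc k) \<le> e k" for k
    by (rule log_convex_null_decreasing[of e, OF e_pos e_sq e_convex])
  have "\<forall>\<^sub>F k in sequentially. e k < \<delta>"
    using summable_squares_LIMSEQ_zero[of e, OF e_pos e_sq e_convex] K(2) by (rule order_tendstoD)
  then obtain N where N: "\<And>k. k \<ge> N \<Longrightarrow> e k < \<delta>" by (auto simp: eventually_sequentially)
  define u where "u k = fst (state z (\<lambda>_. 0) s0 k)" for k
  define y where "y k = norm (u k) / \<alpha> k" for k
  \<comment> \<open>An upper bound for (1 + K d^2)^2 - 1 with d = \<open>e k\<close>: the
    fourth-order term is absorbed using d <= \<delta>.\<close>
  define a where "a k = (2 * K + K\<^sup>2 * \<delta>\<^sup>2) * (e k)\<^sup>2" for k
  \<comment> \<open>The factor 2 is from |sinw d'| <= 2 d' with d' = \<open>e (Suc k)\<close>, the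
    last term from d'(d + d') <= 2 d^2, and 1/\<rho> from comparing neighbouring weights.\<close>
  define b where "b k = 2 / \<rho> * (e (Suc k) * excess k + 2 * K * (e k)\<^sup>2)" for k
  have rec: "y (k + 2) \<le> (1 + a k) * y k + b k * y (k + 1)" if "k \<ge> N" for k
  proof -
    let ?d = "e k" and ?d' = "e (Suc k)"
    let ?s = "sinw z ?d" and ?s' = "sinw z ?d'"
    let ?g = "cosw z ?d / ?s - 1 / of_real ?d" and ?g' = "cosw z ?d' / ?s' - 1 / of_real ?d'"
    define E where "E = \<Lambda> (Suc k) + (1 / e k + 1 / e (Suc k)) *\<^sub>R mat 1"
    have d: "0 < ?d" "?d \<le> \<delta>" and d': "0 < ?d'" "?d' \<le> \<delta>"
      using N[of k] N[of "Suc k"] that e_pos by auto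
    have nzs: "?s \<noteq> 0" "?s' \<noteq> 0" using nz d d' by auto
    have Ev: "E *v v = \<Lambda> (Suc k) *v v + of_real (1 / ?d + 1 / ?d') *s v" for v
      unfolding E_def matrix_vector_mult_add_rdistrib scaleR_identity_matrix_vector ..
    \<comment> \<open>The terms 1/d and 1/d' are moved from the cotangent-like quotients into the
      matrix \<open>E\<close>; only the small remainders \<open>?g\<close> and \<open>?g'\<close>
      stay behind.\<close>
    have "u (Suc (Suc k)) = ?s' *s (E *v u (Suc k) + (?g + ?g') *s u (Suc k)) - (?s' / ?s) *s u k"
      using state_homogeneous_recurrence[OF z, of k s0] nzs d d'
      unfolding Ev by (simp add: u_def e_def[symmetric] vec_eq_iff algebra_simps)
    then have "norm (u (Suc (Suc k))) \<le>
        norm (?s' *s (E *v u (Suc k) + (?g + ?g') *s u (Suc k))) + norm ((?s' / ?s) *s u k)"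
      by (metis norm_triangle_ineq4)
    also have "norm (?s' *s (E *v u (Suc k) + (?g + ?g') *s u (Suc k)))
        \<le> (2 * ?d') * (excess k * norm (u (Suc k)) + (K * ?d + K * ?d') * norm (u (Suc k)))"
    proof -
      have "norm (E *v u (Suc k) + (?g + ?g') *s u (Suc k))
          \<le> norm (E *v u (Suc k)) + norm (?g + ?g') * norm (u (Suc k))"
        using norm_triangle_ineq norm_scalar_mult_vec by metis
      also have "\<dots> \<le> excess k * norm (u (Suc k)) + (K * ?d + K * ?d') * norm (u (Suc k))"
        using cs[OF d] cs[OF d'] norm_matrix_vector_le[of E "u (Suc k)"]
        by (intro add_mono mult_right_mono norm_triangle_le) (auto simp: excess_def E_def)
      finally show ?thesis
        using s2[of ?d'] d' unfolding norm_scalar_mult_vec by (intro mult_mono) auto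
    qed
    also have "norm ((?s' / ?s) *s u k) \<le> (?d' / ?d * (1 + a k)) * norm (u k)"
    proof -
      have "norm (?s' / ?s) = norm ?s' * (?d / norm ?s) / ?d"
        using d by (simp add: norm_divide)
      also have "\<dots> \<le> (?d' * (1 + K * ?d'\<^sup>2)) * (1 + K * ?d\<^sup>2) / ?d"
        using sup[OF d'] slow[OF d] d d' K by (intro divide_right_mono mult_mono) auto
      \<comment> \<open>Since the gaps decrease, both error factors can be expressed by the same gap
        \<open>e k\<close>.\<close>
      also have "\<dots> \<le> (?d' * (1 + K * ?d\<^sup>2)) * (1 + K * ?d\<^sup>2) / ?d"
        using dec[of k] d d' K
        by (intro divide_right_mono mult_right_mono mult_left_mono add_left_mono power_mono) auto
      also have "\<dots> = ?d' / ?d * (1 + 2 * (K * ?d\<^sup>2) + (K * ?d\<^sup>2) * (K * ?d\<^sup>2))"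
        by (simp add: algebra_simps add_divide_distrib)
      also have "\<dots> \<le> ?d' / ?d * (1 + a k)"
      proof -
        have "K * ?d\<^sup>2 \<le> K * \<delta>\<^sup>2" using d K by (intro mult_left_mono power_mono) auto
        then have "(K * ?d\<^sup>2) * (K * ?d\<^sup>2) \<le> (K * \<delta>\<^sup>2) * (K * ?d\<^sup>2)"
          using K by (intro mult_right_mono) auto
        then have "1 + 2 * (K * ?d\<^sup>2) + (K * ?d\<^sup>2) * (K * ?d\<^sup>2) \<le> 1 + a k"
          by (simp add: a_def algebra_simps power2_eq_square)
        then show ?thesis using d d' by (intro mult_left_mono) auto
      qed
      finally show ?thesis unfolding norm_scalar_mult_vec by (rule mult_right_mono) simp
    qed
    finally have main: "norm (u (Suc (Suc k))) \<le>
        2 * ?d' * (excess k + K * ?d + K * ?d') * norm (u (Suc k)) + ?d' / ?d * (1 + a k) * norm (u k)"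
      by (simp add: algebra_simps)
    have nu: "norm (u j) = \<alpha> j * y j" for j using \<alpha>[of j] by (simp add: y_def)
    \<comment> \<open>Passing to \<open>y\<close> turns the main coefficient d'/d into 1.\<close>
    have \<alpha>d: "?d' / ?d * \<alpha> k = \<alpha> (Suc (Suc k))" using \<alpha>_rec[of k] d by (simp add: field_simps)
    have y0: "0 \<le> y j" for j using \<alpha>[of j] by (simp add: y_def)
    have "\<alpha> (Suc (Suc k)) * y (Suc (Suc k)) \<le>
        2 * ?d' * (excess k + K * ?d + K * ?d') * (\<alpha> (Suc k) * y (Suc k))
        + \<alpha> (Suc (Suc k)) * ((1 + a k) * y k)"
      using main unfolding nu by (simp add: \<alpha>d[symmetric] mult_ac)
    also have "2 * ?d' * (excess k + K * ?d + K * ?d') * (\<alpha> (Suc k) * y (Suc k))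
        \<le> (\<rho> * b k) * (\<alpha> (Suc (Suc k)) / \<rho> * y (Suc k))"
    proof (rule mult_mono)
      have "?d' * ?d \<le> ?d * ?d" "?d' * ?d' \<le> ?d * ?d"
        using dec[of k] d d' by (auto intro: mult_mono)
      then have "K * (?d' * ?d) \<le> K * (?d)\<^sup>2" "K * (?d' * ?d') \<le> K * (?d)\<^sup>2"
        using K by (auto simp: power2_eq_square intro: mult_left_mono)
      then show "2 * ?d' * (excess k + K * ?d + K * ?d') \<le> \<rho> * b k"
        using \<rho> by (simp add: b_def algebra_simps)
      \<comment> \<open>The coupling term has the other parity, so it must be measured by a
        neighbouring weight.\<close>
      have "\<alpha> (Suc k) \<le> \<alpha> (Suc (Suc k)) / \<rho>"
        using \<alpha>_low[of "Suc k"] \<rho> by (simp add: pos_le_divide_eq mult.commute)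
      then show "\<alpha> (Suc k) * y (Suc k) \<le> \<alpha> (Suc (Suc k)) / \<rho> * y (Suc k)"
        using y0 by (rule mult_right_mono)
      show "0 \<le> \<rho> * b k"
        using \<rho> d d' K excess_nonneg[of k] by (simp add: b_def)
      show "0 \<le> \<alpha> (Suc k) * y (Suc k)" using \<alpha>[of "Suc k"] y0 by simp
    qed
    also have "\<dots> = \<alpha> (Suc (Suc k)) * (b k * y (Suc k))" using \<rho> by simp
    finally have "\<alpha> (Suc (Suc k)) * y (Suc (Suc k)) \<le>
        \<alpha> (Suc (Suc k)) * ((1 + a k) * y k + b k * y (Suc k))"
      by (simp add: algebra_simps)
    then show ?thesis using \<alpha>[of "Suc (Suc k)"] by simp
  qed
  have "\<exists>M\<ge>0. \<forall>k. y k \<le> M"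
  proof (rule perturbed_recurrence_bounded[of y a b N])
    show "y (k + 2) \<le> (1 + a k) * y k + b k * y (k + 1)" if "k \<ge> N" for k
      using that by (rule rec)
    show "0 \<le> y k" for k using \<alpha>[of k] by (simp add: y_def)
    show "0 \<le> a k" for k using K by (simp add: a_def)
    show "0 \<le> b k" for k using K \<rho> excess_nonneg e_pos by (simp add: b_def less_imp_le)
    show "summable a" unfolding a_def[abs_def] using e_sq by (rule summable_mult)
    show "summable b" unfolding b_def[abs_def]
      using excess_summable e_sq by (intro summable_mult summable_add)
  qed
  then obtain M where M: "M \<ge> 0" "\<And>k. y k \<le> M" by blast
  show thesis
  proof (rule that[of "M\<^sup>2 / \<rho>"])
    show "0 \<le> M\<^sup>2 / \<rho>" using \<rho> by simp
    fix k
    have "norm (u k) \<le> M * \<alpha> k"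
      using M(2)[of k] \<alpha>[of k] by (simp add: y_def pos_divide_le_eq)
    then have "(norm (u k))\<^sup>2 \<le> (M * \<alpha> k)\<^sup>2" by (rule power_mono) simp
    also have "\<dots> = M\<^sup>2 / \<rho> * (\<rho> * (\<alpha> k)\<^sup>2)" using \<rho> by (simp add: power_mult_distrib)
    also have "\<dots> \<le> M\<^sup>2 / \<rho> * e k" using \<alpha>_sq \<rho> by (intro mult_left_mono) auto
    finally show "(norm (fst (state z (\<lambda>_. 0) s0 k)))\<^sup>2 \<le> M\<^sup>2 / \<rho> * e k" by (simp add: u_def)
  qed
qed

text \<open>Solving the transfer relation for the derivative at the left end costs a factor 2/d,
  which \<open>sinw\<close> inside the cell, at most 2 d, compensates. So the solution is bounded by
  its values at both ends of the cell.\<close>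

lemma homogeneous_sol_square_integrable:
  assumes z: "z \<noteq> 0"
  shows "square_integrable halfline (sol z (\<lambda>_. 0) s0)"
proof -
  obtain \<delta> where \<delta>: "\<delta> > 0"
    and nz: "\<And>d. 0 < d \<Longrightarrow> d \<le> \<delta> \<Longrightarrow> sinw z d \<noteq> 0"
    and s2: "\<And>d. 0 \<le> d \<Longrightarrow> d \<le> \<delta> \<Longrightarrow> norm (sinw z d) \<le> 2 * d"
    and slow: "\<And>d. 0 \<le> d \<Longrightarrow> d \<le> \<delta> \<Longrightarrow> d / 2 \<le> norm (sinw z d)"
    and c2: "\<And>d. 0 \<le> d \<Longrightarrow> d \<le> \<delta> \<Longrightarrow> norm (cosw z d) \<le> 2"
  proof (rule sinw_cosw_small[OF z], goal_cases)
    case (1 K \<delta>)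
    show ?thesis by (rule 1(1)[of \<delta>]) (fact 1)+
  qed
  obtain M where M: "M \<ge> 0" "\<And>k. (norm (fst (state z (\<lambda>_. 0) s0 k)))\<^sup>2 \<le> M * e k"
    using state_growth[OF z] by blast
  have dec: "e (Suc k) \<le> e k" for k
    by (rule log_convex_null_decreasing[of e, OF e_pos e_sq e_convex])
  have "\<forall>\<^sub>F k in sequentially. e k < \<delta>"
    using summable_squares_LIMSEQ_zero[of e, OF e_pos e_sq e_convex] \<delta> by (rule order_tendstoD)
  then obtain N where N: "\<And>k. k \<ge> N \<Longrightarrow> e k < \<delta>" by (auto simp: eventually_sequentially)
  have hom: "flow z (\<lambda>_. 0) (x k) s t = (cosw z (t - x k) *s fst s + sinw z (t - x k) *s snd s,
     cosw z (t - x k) *s snd s + (- (z * sinw z (t - x k))) *s fst s)" for k s t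
    by (rule flow_homogeneous) simp
  show ?thesis
  \<comment> \<open>The constant is 10^2 from the cell estimate, 2 from squaring a sum, and 2 from
    the two ends, each bounded by \<open>M * e k\<close>.\<close>
  proof (rule square_integrable_cells[where N = N and B = "\<lambda>k. (400 * M) * e k"])
    show "continuous_on {x k..x (Suc k)} (\<lambda>t. fst (flow z (\<lambda>_. 0) (x k) (state z (\<lambda>_. 0) s0 k) t))" for k
      by (rule ac_on_continuous[OF flow_ac(1)[OF z _ x_le_Suc]]) simp
    show "summable (\<lambda>k. (400 * M) * e k * (x (Suc k) - x k))"
      using summable_mult[OF e_sq, of "400 * M"]
      by (simp add: e_def[symmetric] power2_eq_square mult.assoc)
    fix k t assume t: "x k \<le> t" "t < x (Suc k)"
    show "sol z (\<lambda>_. 0) s0 t = fst (flow z (\<lambda>_. 0) (x k) (state z (\<lambda>_. 0) s0 k) t)"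
      by (rule sol_cell(1)[OF t])
    assume k: "k \<ge> N"
    define u where "u j = fst (state z (\<lambda>_. 0) s0 j)" for j
    let ?b = "snd (state z (\<lambda>_. 0) s0 k)" and ?d = "e k" and ?r = "t - x k"
    have d: "0 < ?d" "?d \<le> \<delta>" "0 \<le> ?r" "?r \<le> ?d" "?r \<le> \<delta>"
      using e_pos N[OF k] t by (auto simp: e_def)
    have "u (Suc k) = cosw z ?d *s u k + sinw z ?d *s ?b"
      by (simp add: u_def hom Let_def e_def)
    then have b: "?b = (1 / sinw z ?d) *s (u (Suc k) - cosw z ?d *s u k)"
      using nz[OF d(1,2)] by simp
    have "norm ?b \<le> (2 / ?d) * (norm (u (Suc k)) + 2 * norm (u k))"
      unfolding b norm_scalar_mult_vec
    proof (rule mult_mono)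
      have "1 / norm (sinw z ?d) \<le> 1 / (?d / 2)"
        using slow[of ?d] d nz[OF d(1,2)] by (intro divide_left_mono) auto
      then show "norm (1 / sinw z ?d) \<le> 2 / ?d" by (simp add: norm_divide)
      have "norm (cosw z ?d *s u k) \<le> 2 * norm (u k)"
        unfolding norm_scalar_mult_vec using c2[of ?d] d by (intro mult_right_mono) auto
      then show "norm (u (Suc k) - cosw z ?d *s u k) \<le> norm (u (Suc k)) + 2 * norm (u k)"
        using norm_triangle_ineq4[of "u (Suc k)" "cosw z ?d *s u k"] by linarith
    qed (use d in auto)
    then have "norm (sinw z ?r *s ?b) \<le> (2 * ?d) * ((2 / ?d) * (norm (u (Suc k)) + 2 * norm (u k)))"
      unfolding norm_scalar_mult_vec using s2[of ?r] d by (intro mult_mono) auto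
    also have "\<dots> = 4 * norm (u (Suc k)) + 8 * norm (u k)" using d by simp
    finally have 1: "norm (sinw z ?r *s ?b) \<le> 4 * norm (u (Suc k)) + 8 * norm (u k)" .
    have 2: "norm (cosw z ?r *s u k) \<le> 2 * norm (u k)"
      unfolding norm_scalar_mult_vec using c2[of ?r] d by (intro mult_right_mono) auto
    have "norm (sol z (\<lambda>_. 0) s0 t) \<le> 10 * (norm (u k) + norm (u (Suc k)))"
      unfolding sol_cell(1)[OF t] hom fst_conv u_def[symmetric]
      using norm_triangle_ineq[of "cosw z ?r *s u k" "sinw z ?r *s ?b"] 1 2
        norm_ge_zero[of "u (Suc k)"]
      unfolding distrib_left by linarith
    then have "(norm (sol z (\<lambda>_. 0) s0 t))\<^sup>2 \<le> (10 * (norm (u k) + norm (u (Suc k))))\<^sup>2"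
      by (rule power_mono) simp
    also have "\<dots> \<le> 200 * ((norm (u k))\<^sup>2 + (norm (u (Suc k)))\<^sup>2)"
      using sum_squares_bound[of "norm (u k)" "norm (u (Suc k))"]
      by (simp add: power2_eq_square algebra_simps)
    also have "\<dots> \<le> 200 * (M * e k + M * e k)"
    proof -
      have "M * e (Suc k) \<le> M * e k" using dec M(1) by (rule mult_left_mono)
      then have "(norm (u (Suc k)))\<^sup>2 \<le> M * e k"
        unfolding u_def using M(2) order_trans by blast
      moreover have "(norm (u k))\<^sup>2 \<le> M * e k" unfolding u_def by (rule M(2))
      ultimately show ?thesis by simp
    qed
    finally show "(norm (sol z (\<lambda>_. 0) s0 t))\<^sup>2 \<le> (400 * M) * e k" by simp
  qed
qed

end

section \<open>The kernel of the adjoint\<close>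

lemma L2_eq_refl: "square_integrable halfline f \<Longrightarrow> L2_eq f f"
  by (simp add: L2_eq_def)

lemma to_L2_eq_iff:
  assumes "square_integrable halfline f" "square_integrable halfline g"
  shows "to_L2 f = to_L2 g \<longleftrightarrow> (AE t in halfline. f t = g t)"
  using Quotient_rel[OF Quotient_L2, of f g] assms unfolding to_L2_def L2_eq_def by auto

lemma to_L2_cases:
  obtains v where "square_integrable halfline v" "u = to_L2 v"
  using Quotient_rep_reflp[OF Quotient_L2, of u] Quotient_abs_rep[OF Quotient_L2, of u]
  unfolding to_L2_def L2_eq_def by metis

lemma cinner_to_L2:
  assumes "square_integrable halfline f" "square_integrable halfline g"
  shows "cinner (to_L2 f) (to_L2 g) = integral\<^sup>L halfline (\<lambda>t. vec_cinner (f t) (g t))"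
  unfolding to_L2_def by (rule cinner.abs_eq[OF L2_eq_refl L2_eq_refl]) fact+

lemma cscale_to_L2:
  "square_integrable halfline f \<Longrightarrow> cscale c (to_L2 f) = to_L2 (\<lambda>t. c *s f t)"
  unfolding to_L2_def by (rule cscale.abs_eq[OF L2_eq_refl])

lemma plus_to_L2:
  assumes "square_integrable halfline f" "square_integrable halfline g"
  shows "to_L2 f + to_L2 g = to_L2 (\<lambda>t. f t + g t)"
  unfolding to_L2_def by (rule plus_L2.abs_eq[OF L2_eq_refl L2_eq_refl]) fact+

lemma square_integrable_uminus:
  "square_integrable M f \<Longrightarrow> square_integrable M (\<lambda>t. - f t)"
  using square_integrable_scale[of M f "-1"] by simp

lemma square_integrable_diff:
  assumes "square_integrable M f" "square_integrable M g"
  shows "square_integrable M (\<lambda>t. f t - g t)"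
  using square_integrable_add[OF assms(1) square_integrable_uminus[OF assms(2)]] by simp

lemma square_integrable_truncate:
  assumes "square_integrable halfline f"
  shows "square_integrable halfline (\<lambda>t. if t \<le> r then f t else 0)"
proof -
  have f: "f \<in> borel_measurable halfline" "integrable halfline (\<lambda>t. (norm (f t))\<^sup>2)"
    using assms by (auto simp: square_integrable_def)
  have m: "(\<lambda>t. if t \<in> {..r} then f t else 0) \<in> borel_measurable halfline"
    using f(1) by (intro measurable_If_set) (auto simp: sets_restrict_space_iff)
  have "integrable halfline (\<lambda>t. (norm (if t \<in> {..r} then f t else 0))\<^sup>2)"
    by (rule Bochner_Integration.integrable_bound[OF f(2)]) (use m in auto)
  with m show ?thesis by (simp add: square_integrable_def)
qed

lemma cinner_conv_inner: "cinner f u = Complex (f \<bullet> u) (f \<bullet> cscale \<i> u)"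
proof -
  have "cinner f (cscale \<i> u) = cnj (\<i> * cinner u f)"
    by (subst cinner_commute) (simp add: cinner_cscale_left)
  also have "\<dots> = - \<i> * cinner f u"
    by (subst (2) cinner_commute) simp
  finally show ?thesis by (simp add: inner_L2_def complex_eq_iff)
qed

text \<open>For a fixed pair (u, v) the defining condition is closed in (f, g). Splitting the
  complex identity into two real inner products makes continuity available.\<close>

lemma adjoint_graph_closure: "adjoint_graph (closure T) = adjoint_graph T"
proof
  show "adjoint_graph (closure T) \<subseteq> adjoint_graph T"
    unfolding adjoint_graph_def using closure_subset[of T] by blast
  show "adjoint_graph T \<subseteq> adjoint_graph (closure T)"
  proof
    fix w assume w: "w \<in> adjoint_graph T"
    obtain u v where uv: "w = (u, v)" by (cases w)
    let ?S = "{q. snd q \<bullet> u = fst q \<bullet> v} \<inter> {q. snd q \<bullet> cscale \<i> u = fst q \<bullet> cscale \<i> v}"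
    have "closed ?S"
      by (intro closed_Int closed_Collect_eq continuous_intros)
    moreover have "T \<subseteq> ?S"
      using w unfolding adjoint_graph_def uv by (auto simp: cinner_conv_inner)
    ultimately have "closure T \<subseteq> ?S" by (rule closure_minimal[rotated])
    then show "w \<in> adjoint_graph (closure T)"
      unfolding adjoint_graph_def uv by (auto simp: cinner_conv_inner)
  qed
qed

text \<open>\<open>cosw z\<close> is 1 at 0, hence nonzero on an interval of positive
  measure.\<close>

lemma cosw_AE_zero_imp_zero:
  fixes c :: "complex ^ 'p"
  assumes "0 < r" "AE t in halfline. t < r \<longrightarrow> cosw z t *s c = 0"
  shows "c = 0"
proof (rule ccontr)
  assume "c \<noteq> 0"
  have "(cosw z \<longlongrightarrow> cosw z 0) (at_right 0)"
    using continuous_on_cosw[of UNIV "\<lambda>t. t" z]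
    by (metis UNIV_I continuous_on_def continuous_on_id tendsto_within_subset subset_UNIV)
  then have "\<forall>\<^sub>F t in at_right 0. cosw z t \<noteq> 0"
    by (rule tendsto_imp_eventually_ne) simp
  then obtain b where b: "0 < b" "\<And>t. 0 < t \<Longrightarrow> t < b \<Longrightarrow> cosw z t \<noteq> 0"
    unfolding eventually_at_right_field by auto
  define s where "s = min b r"
  have s: "0 < s" using b assms by (simp add: s_def)
  let ?A = "{0<..<s}"
  have A: "?A \<in> sets halfline" by (simp add: sets_restrict_space_iff) auto
  have "AE t in halfline. t \<notin> ?A"
    using assms(2)
  proof eventually_elim
    case (elim t)
    show ?case
    proof
      assume t: "t \<in> ?A"
      then have "cosw z t \<noteq> 0" "cosw z t *s c = 0" using elim b(2)[of t] by (auto simp: s_def)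
      with \<open>c \<noteq> 0\<close> show False by (simp add: vector_mul_eq_0)
    qed
  qed
  then have "emeasure halfline ?A = 0"
    using AE_iff_null_sets[OF A] by auto
  moreover have "emeasure halfline ?A = emeasure lebesgue ?A"
    by (rule emeasure_restrict_space) auto
  ultimately show False using s by simp
qed

section \<open>The linear family of solutions with Neumann data at 0\<close>

context point_interactions
begin

definition usol :: "complex \<Rightarrow> complex ^ 'p \<Rightarrow> real \<Rightarrow> complex ^ 'p"
  where "usol z c = sol z (\<lambda>_. 0) (c, 0)"

lemma state_linear:
  "state z (\<lambda>_. 0) (a *s p + p', a *s q + q') k =
    (a *s fst (state z (\<lambda>_. 0) (p, q) k) + fst (state z (\<lambda>_. 0) (p', q') k),
     a *s snd (state z (\<lambda>_. 0) (p, q) k) + snd (state z (\<lambda>_. 0) (p', q') k))"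
proof (induction k)
  case (Suc k)
  show ?case
    unfolding state.simps Suc flow_homogeneous[OF refl] Let_def fst_conv snd_conv
    by (simp only: prod.inject matrix_vector_right_distrib vector_scalar_commute)
      (simp add: vec_eq_iff algebra_simps)
qed simp

lemma usol_linear: "usol z (a *s c + c') t = a *s usol z c t + usol z c' t"
proof -
  have "(a *s c + c', 0) = (a *s c + c', a *s 0 + 0 :: complex ^ 'p)" by simp
  then show ?thesis
    unfolding usol_def sol_def sol_pair_def
    by (simp only: state_linear flow_homogeneous[OF refl] fst_conv snd_conv)
      (simp add: vec_eq_iff algebra_simps)
qed

lemma usol_zero: "usol z 0 t = 0"
  using usol_linear[of z "-1" 0 0 t] by simp

lemma usol_scale: "usol z (a *s c) t = a *s usol z c t"
  using usol_linear[of z a c 0 t] by (simp add: usol_zero)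

lemma usol_add: "usol z (c + c') t = usol z c t + usol z c' t"
  using usol_linear[of z 1 c c' t] by simp

lemma usol_diff: "usol z (c - c') t = usol z c t - usol z c' t"
  using usol_linear[of z "-1" c' c t] by simp

lemma usol_sum: "finite I \<Longrightarrow> usol z (\<Sum>i\<in>I. c i) t = (\<Sum>i\<in>I. usol z (c i) t)"
  by (induction I rule: finite_induct) (simp_all add: usol_zero usol_add)

lemma usol_basis: "usol z c t = (\<Sum>i\<in>UNIV. c $ i *s usol z (axis i 1) t)"
proof -
  have "c = (\<Sum>i\<in>UNIV. c $ i *s axis i 1)" by (simp add: basis_expansion)
  then have "usol z c t = usol z (\<Sum>i\<in>UNIV. c $ i *s axis i 1) t" by simp
  then show ?thesis by (simp only: usol_sum[OF finite] usol_scale)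
qed

lemma usol_first_cell: "0 \<le> t \<Longrightarrow> t < x 1 \<Longrightarrow> usol z c t = cosw z t *s c"
  using sol_cell(1)[of 0 t z "\<lambda>_. 0" "(c, 0)"]
  by (simp add: usol_def flow_homogeneous)

text \<open>The explicit form on the first cell already determines \<open>c\<close>; no uniqueness
  theorem for the equation is required.\<close>

lemma usol_AE_zero:
  assumes "n \<ge> 1" "AE t in halfline. t \<le> x n \<longrightarrow> usol z c t = 0"
  shows "c = 0"
proof (rule cosw_AE_zero_imp_zero)
  show "0 < x 1" using x_less[of 0 1] by simp
  have "AE t in halfline. 0 < t" by (rule AE_I2) simp
  with assms(2) show "AE t in halfline. t < x 1 \<longrightarrow> cosw z t *s c = 0"
  proof eventually_elim
    case (elim t)
    then show ?case using x_mono[OF assms(1)] usol_first_cell[of t z c] by auto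
  qed
qed

lemma usol_admissible:
  assumes "z \<noteq> 0"
  shows "admissible (usol z c) (dsol z (\<lambda>_. 0) (c, 0)) (\<lambda>t. - (z *s usol z c t))"
  using sol_admissible[OF assms square_integrable_zero, of "(c, 0)"] by (simp add: usol_def)

lemma usol_start:
  assumes "z \<noteq> 0"
  shows "right_lim (usol z c) 0 = c" "right_lim (dsol z (\<lambda>_. 0) (c, 0)) 0 = 0"
  using sol_right_lim[OF assms square_integrable_zero, of "(c, 0)" 0] by (simp_all add: usol_def)

text \<open>Every transfer step can be undone: first the jump, then the flow. This allows data to be
  prescribed at \<open>x n\<close> instead of at 0.\<close>

lemma state_surj:
  assumes z: "z \<noteq> 0"
  shows "\<exists>s. state z h s n = y"
proof (induction n arbitrary: y)
  case (Suc n)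
  obtain s1 where s1: "flow z h (x n) s1 (x (Suc n)) = (fst y, snd y - \<Lambda> (Suc n) *v fst y)"
    using flow_surj[OF z] by blast
  obtain s where "state z h s n = s1" using Suc by blast
  then show ?case using s1 by (intro exI[of _ s]) (simp add: Let_def)
qed simp

lemma sol_zero_beyond:
  assumes "state z h s n = (0, 0)" "\<And>t. t > x n \<Longrightarrow> h t = 0" and "z \<noteq> 0"
    and h: "square_integrable halfline h" and "t > x n"
  shows "sol z h s t = 0"
proof -
  have fl: "flow z h (x k) (0, 0) t = (0, 0)" if "k \<ge> n" for k t
  proof -
    have "integral {x k..t} (\<lambda>r. g r *s h r) = 0" for g :: "real \<Rightarrow> complex"
    proof -
      have "integral {x k..t} (\<lambda>r. g r *s h r) = integral {x k..t} (\<lambda>r. 0)"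
      \<comment> \<open>For \<open>k = n\<close> the function \<open>h\<close> may be nonzero at the
        left end itself, a single point.\<close>
      proof (rule integral_spike[of "{x k}"])
        fix r assume "r \<in> {x k..t} - {x k}"
        then have "r > x n" using x_mono[OF that] by auto
        then show "0 = g r *s h r" using assms(2) by simp
      qed simp
      then show ?thesis by simp
    qed
    then show ?thesis by (simp add: flow_def Let_def)
  qed
  have st: "state z h s (n + j) = (0, 0)" for j
    by (induction j) (simp_all add: assms(1) fl Let_def)
  have t0: "0 \<le> t" using assms(5) x_nonneg[of n] by linarith
  have "n \<le> cell t"
  proof (rule ccontr)
    assume "\<not> n \<le> cell t"
    then have "x (Suc (cell t)) \<le> x n" by (intro x_mono) simp
    then show False using cell_bounds(2)[OF t0] assms(5) by simp
  qed
  then show ?thesis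
    using st[of "cell t - n"] fl[of "cell t"] by (simp add: sol_def sol_pair_def)
qed

lemma pre_hamiltonian_iff:
  "p \<in> pre_hamiltonian x \<Lambda> \<longleftrightarrow> (\<exists>f f' f''. p = (to_L2 f, to_L2 (\<lambda>t. - f'' t)) \<and>
    square_integrable halfline f \<and> square_integrable halfline f'' \<and> (\<exists>R. \<forall>t>R. f t = 0) \<and>
    admissible f f' f'' \<and> right_lim f' 0 = 0)"
  unfolding pre_hamiltonian_def admissible_def by blast

text \<open>Both derivatives vanish at 0, so Green's formula leaves no boundary term.\<close>

lemma usol_mem_eigenkernel:
  assumes z: "z \<noteq> 0" and U: "square_integrable halfline (usol z c)"
  shows "to_L2 (usol z c) \<in> eigenkernel (adjoint_graph (pre_hamiltonian x \<Lambda>)) z"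
proof -
  have "cinner g (to_L2 (usol z c)) = cinner p (cscale z (to_L2 (usol z c)))"
    if pg: "(p, g) \<in> pre_hamiltonian x \<Lambda>" for p g
  proof -
    obtain f f' f'' R where p: "p = to_L2 f" "g = to_L2 (\<lambda>t. - f'' t)"
      and sq: "square_integrable halfline f" "square_integrable halfline f''"
      and R: "\<And>t. t > R \<Longrightarrow> f t = 0" and adm: "admissible f f' f''" and f'0: "right_lim f' 0 = 0"
      using pg unfolding pre_hamiltonian_iff by blast
    have zU: "square_integrable halfline (\<lambda>t. z *s usol z c t)"
      using U by (rule square_integrable_scale)
    have "integral\<^sup>L halfline (\<lambda>t. vec_cinner (f'' t) (usol z c t)) -
      integral\<^sup>L halfline (\<lambda>t. vec_cinner (f t) (- (z *s usol z c t))) = 0"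
      using lagrange_halfline[OF adm usol_admissible[OF z] sq U square_integrable_uminus[OF zU] R]
      unfolding boundary_form_def usol_start[OF z] f'0 by (simp add: vcinner.zero_left vcinner.zero_right)
    then have "- integral\<^sup>L halfline (\<lambda>t. vec_cinner (f'' t) (usol z c t)) =
        integral\<^sup>L halfline (\<lambda>t. vec_cinner (f t) (z *s usol z c t))"
      by (simp add: vcinner.minus_right add_eq_0_iff)
    then show ?thesis
      unfolding p cscale_to_L2[OF U] cinner_to_L2[OF square_integrable_uminus[OF sq(2)] U]
        cinner_to_L2[OF sq(1) zU] by (simp add: vcinner.minus_left)
  qed
  then show ?thesis unfolding eigenkernel_def adjoint_graph_def by auto
qed

text \<open>Moving z out of the second slot conjugates it: for \<open>f\<close> in the domain,
  membership of v in the kernel says that f'' + conj(z) f is orthogonal to v. It remains to realise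
  \<open>h\<close> as this expression.\<close>

lemma eigenkernel_orthogonal:
  assumes z: "z \<noteq> 0" and U: "\<And>c. square_integrable halfline (usol z c)"
    and v: "square_integrable halfline v"
    and ker: "to_L2 v \<in> eigenkernel (adjoint_graph (pre_hamiltonian x \<Lambda>)) z"
    and h: "square_integrable halfline h" "\<And>t. t > x n \<Longrightarrow> h t = 0"
    and orth: "\<And>c. integral\<^sup>L halfline (\<lambda>t. vec_cinner (h t) (usol z c t)) = 0"
  shows "integral\<^sup>L halfline (\<lambda>t. vec_cinner (h t) (v t)) = 0"
proof -
  let ?\<zeta> = "cnj z"
  have \<zeta>: "?\<zeta> \<noteq> 0" using z by simp
  obtain s where s: "state ?\<zeta> h s n = (0, 0)" using state_surj[OF \<zeta>] by blast
  define f where "f = sol ?\<zeta> h s"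
  define f' where "f' = dsol ?\<zeta> h s"
  define f'' where "f'' t = - (?\<zeta> *s f t) + h t" for t
  have zero: "f t = 0" if "t > x n" for t
    unfolding f_def by (rule sol_zero_beyond[OF s h(2) \<zeta> h(1) that])
  have adm: "admissible f f' f''"
    using sol_admissible[OF \<zeta> h(1), of s] by (simp add: f_def f'_def f''_def[abs_def])
  have sqf: "square_integrable halfline f"
  \<comment> \<open>The tail starts at \<open>Suc n\<close> because cell \<open>n\<close> contains
    the point \<open>x n\<close>, where \<open>f\<close> is not claimed to vanish.\<close>
  proof (rule square_integrable_cells[where N = "Suc n" and B = "\<lambda>_. 0"])
    fix k
    show "continuous_on {x k..x (Suc k)} (\<lambda>t. fst (flow ?\<zeta> h (x k) (state ?\<zeta> h s k) t))"
      by (rule ac_on_continuous[OF flow_ac(1)[OF \<zeta>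
            square_integrable_imp_absolutely_integrable[OF h(1) x_nonneg] x_le_Suc]])
    fix t assume t: "x k \<le> t" "t < x (Suc k)"
    show "f t = fst (flow ?\<zeta> h (x k) (state ?\<zeta> h s k) t)"
      unfolding f_def by (rule sol_cell(1)[OF t])
    assume "Suc n \<le> k"
    then have "x n < t" using x_less[of n k] t by simp
    then show "(norm (f t))\<^sup>2 \<le> 0" using zero by simp
  qed simp
  have sqf'': "square_integrable halfline f''"
    unfolding f''_def[abs_def]
    by (intro square_integrable_add square_integrable_uminus square_integrable_scale sqf h(1))
  have int: "integrable halfline (\<lambda>t. vec_cinner (f'' t) (w t))"
    "integrable halfline (\<lambda>t. vec_cinner (f t) (w t))" "integrable halfline (\<lambda>t. vec_cinner (h t) (w t))"
    if "square_integrable halfline w" for w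
    using that sqf sqf'' h(1) by (auto intro: integrable_vec_cinner)
  have split: "integral\<^sup>L halfline (\<lambda>t. vec_cinner (f'' t) (w t)) +
      ?\<zeta> * integral\<^sup>L halfline (\<lambda>t. vec_cinner (f t) (w t)) =
      integral\<^sup>L halfline (\<lambda>t. vec_cinner (h t) (w t))" if w: "square_integrable halfline w" for w
  proof -
    have "integral\<^sup>L halfline (\<lambda>t. vec_cinner (f'' t) (w t)) +
      ?\<zeta> * integral\<^sup>L halfline (\<lambda>t. vec_cinner (f t) (w t)) =
      integral\<^sup>L halfline (\<lambda>t. vec_cinner (f'' t) (w t) + ?\<zeta> * vec_cinner (f t) (w t))"
      using int[OF w] by simp
    also have "\<dots> = integral\<^sup>L halfline (\<lambda>t. vec_cinner (h t) (w t))"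
      by (intro Bochner_Integration.integral_cong refl)
        (simp add: f''_def vcinner.add_left vcinner.diff_left vcinner.minus_left vec_cinner_scale_left)
    finally show ?thesis .
  qed
  have f0: "right_lim f' 0 = snd s"
    using sol_right_lim(2)[OF \<zeta> h(1), of s 0] by (simp add: f'_def)
  have "vec_cinner (snd s) c = 0" for c
  proof -
    have "integral\<^sup>L halfline (\<lambda>t. vec_cinner (f'' t) (usol z c t)) -
      integral\<^sup>L halfline (\<lambda>t. vec_cinner (f t) (- (z *s usol z c t))) =
      - vec_cinner (snd s) c"
      using lagrange_halfline[OF adm usol_admissible[OF z] sqf sqf'' U
          square_integrable_uminus[OF square_integrable_scale[OF U]] zero]
      unfolding boundary_form_def usol_start[OF z] f0 by (simp add: vcinner.zero_right)
    moreover have "integral\<^sup>L halfline (\<lambda>t. vec_cinner (f t) (- (z *s usol z c t))) =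
        - (?\<zeta> * integral\<^sup>L halfline (\<lambda>t. vec_cinner (f t) (usol z c t)))"
      by (simp add: vcinner.minus_right vec_cinner_scale_right)
    ultimately show ?thesis using split[OF U, of c] orth[of c] by simp
  qed
  from this[of "snd s"] have "snd s = 0" by (simp add: vec_cinner_self)
  then have "(to_L2 f, to_L2 (\<lambda>t. - f'' t)) \<in> pre_hamiltonian x \<Lambda>"
    unfolding pre_hamiltonian_iff using sqf sqf'' zero adm f0
    by (intro exI[of _ f] exI[of _ f'] exI[of _ f''] conjI refl exI[of _ "x n"]) auto
  then have "cinner (to_L2 (\<lambda>t. - f'' t)) (to_L2 v) = cinner (to_L2 f) (cscale z (to_L2 v))"
    using ker unfolding eigenkernel_def adjoint_graph_def by blast
  then have "- integral\<^sup>L halfline (\<lambda>t. vec_cinner (f'' t) (v t)) =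
      ?\<zeta> * integral\<^sup>L halfline (\<lambda>t. vec_cinner (f t) (v t))"
    unfolding cscale_to_L2[OF v] cinner_to_L2[OF square_integrable_uminus[OF sqf''] v]
      cinner_to_L2[OF sqf square_integrable_scale[OF v]]
    by (simp add: vcinner.minus_left vec_cinner_scale_right)
  with split[OF v] show ?thesis by (metis add.right_inverse)
qed

text \<open>A least-squares fit on (0, x n): \<open>A\<close> collects the pairings with the basis
  solutions, and c solves the normal equations. At this stage c may depend on
  \<open>n\<close>.\<close>

lemma eigenkernel_local:
  assumes z: "z \<noteq> 0" and U: "\<And>c. square_integrable halfline (usol z c)"
    and v: "square_integrable halfline v"
    and ker: "to_L2 v \<in> eigenkernel (adjoint_graph (pre_hamiltonian x \<Lambda>)) z"
    and n: "n \<ge> 1"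
  shows "\<exists>c. AE t in halfline. t \<le> x n \<longrightarrow> v t = usol z c t"
proof -
  define T where "T w t = (if t \<le> x n then w t else 0)" for w :: "real \<Rightarrow> complex ^ 'p" and t
  define A where "A w = (\<chi> i. integral\<^sup>L halfline (\<lambda>t. vec_cinner (T w t) (usol z (axis i 1) t)))" for w
  have T: "square_integrable halfline (T w)" if "square_integrable halfline w" for w
    using square_integrable_truncate[OF that] by (simp add: T_def[abs_def])
  have int: "integrable halfline (\<lambda>t. vec_cinner (T w t) (usol z c t))"
    if "square_integrable halfline w" for w c
    by (rule integrable_vec_cinner[OF T[OF that] U])
  have A_zero: "integral\<^sup>L halfline (\<lambda>t. vec_cinner (T w t) (usol z c t)) = 0"
    if w: "square_integrable halfline w" and "A w = 0" for w c
  proof -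
    have "integral\<^sup>L halfline (\<lambda>t. vec_cinner (T w t) (usol z c t)) =
        integral\<^sup>L halfline (\<lambda>t. \<Sum>i\<in>UNIV. cnj (c $ i) * vec_cinner (T w t) (usol z (axis i 1) t))"
      by (subst usol_basis) (simp add: vcinner.sum_right vec_cinner_scale_right)
    also have "\<dots> = (\<Sum>i\<in>UNIV. cnj (c $ i) * A w $ i)"
      using int[OF w] by (simp add: A_def)
    finally show ?thesis using that(2) by simp
  qed
  have zero: "AE t in halfline. T w t = 0"
    if w: "square_integrable halfline w"
      and i: "integral\<^sup>L halfline (\<lambda>t. vec_cinner (T w t) (w t)) = 0" for w
  proof -
    have "vec_cinner (T w t) (w t) = of_real ((norm (T w t))\<^sup>2)" for t
      by (simp add: T_def vec_cinner_self vcinner.zero_left)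
    then have "integral\<^sup>L halfline (\<lambda>t. (norm (T w t))\<^sup>2) = 0"
      using i by (simp del: of_real_power)
    moreover have "integrable halfline (\<lambda>t. (norm (T w t))\<^sup>2)"
      using T[OF w] by (simp add: square_integrable_def)
    ultimately have "AE t in halfline. (norm (T w t))\<^sup>2 = 0"
      by (subst (asm) integral_nonneg_eq_0_iff_AE) auto
    then show ?thesis by simp
  qed
  have lin: "A (\<lambda>t. a *s w t + w' t) = a *s A w + A w'"
    if "square_integrable halfline w" "square_integrable halfline w'" for a w w'
  proof -
    have "integral\<^sup>L halfline (\<lambda>t. vec_cinner (T (\<lambda>t. a *s w t + w' t) t) (usol z c t)) =
        integral\<^sup>L halfline (\<lambda>t. a * vec_cinner (T w t) (usol z c t) + vec_cinner (T w' t) (usol z c t))" for c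
      by (intro Bochner_Integration.integral_cong refl)
        (simp add: T_def vcinner.add_left vec_cinner_scale_left vcinner.zero_left)
    then show ?thesis using that by (simp add: A_def vec_eq_iff int)
  qed
  \<comment> \<open>\<open>G\<close> is the Gram matrix of the basis solutions on \<open>(0, x n)\<close>.\<close>
  define G where "G c = A (usol z c)" for c
  have *: "G (a *s c + c') = a *s G c + G c'" for a c c'
    unfolding G_def using lin[OF U U, of a c c'] by (simp add: usol_linear[abs_def])
  have G_lin: "Vector_Spaces.linear (*s) (*s) G"
  proof
    show "G (c + c') = G c + G c'" for c c' using *[of 1 c c'] by simp
    have "G 0 = 0" using *[of "-1" 0 0] by simp
    then show "G (a *s c) = a *s G c" for a c using *[of a c 0] by simp
  qed
  \<comment> \<open>If \<open>G c = 0\<close>, the cut-off solution is orthogonal to itself.\<close>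
  have "inj G"
  proof -
    have "c = 0" if "G c = 0" for c
    proof -
      have "AE t in halfline. T (usol z c) t = 0"
        by (rule zero[OF U]) (rule A_zero[OF U], use that in \<open>simp add: G_def\<close>)
      then show ?thesis
        by (intro usol_AE_zero[OF n]) (auto elim!: eventually_mono simp: T_def)
    qed
    note ker_G = this
    show ?thesis
    proof (rule injI)
      fix c c' assume "G c = G c'"
      then have "G (c - c') = 0" using *[of "-1" c' c] by simp
      then have "c - c' = 0" by (rule ker_G)
      then show "c = c'" by simp
    qed
  qed
  then have "surj G" by (rule vec.linear_inj_imp_surj[OF G_lin])
  then obtain c where c: "G c = A v" by (metis surjD)
  define w where "w t = v t - usol z c t" for t
  have w: "square_integrable halfline w"
    unfolding w_def[abs_def] by (rule square_integrable_diff[OF v U])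
  have Aw: "A w = 0"
    using lin[OF U v, of "-1" c] c by (simp add: G_def w_def[abs_def])
  \<comment> \<open>The truncated difference is orthogonal to \<open>v\<close> and to the fitted
    solution, hence to \<open>w\<close>; that pairing is its own squared norm.\<close>
  have "integral\<^sup>L halfline (\<lambda>t. vec_cinner (T w t) (v t)) = 0"
    by (rule eigenkernel_orthogonal[OF z U v ker T[OF w], of n])
      (simp_all add: T_def[of w] A_zero[OF w Aw, unfolded T_def])
  moreover have "integral\<^sup>L halfline (\<lambda>t. vec_cinner (T w t) (usol z c t)) = 0"
    by (rule A_zero[OF w Aw])
  moreover have "integral\<^sup>L halfline (\<lambda>t. vec_cinner (T w t) (w t)) =
      integral\<^sup>L halfline (\<lambda>t. vec_cinner (T w t) (v t)) - integral\<^sup>L halfline (\<lambda>t. vec_cinner (T w t) (usol z c t))"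
    unfolding w_def vcinner.diff_right[of "T _ _"]
    by (rule Bochner_Integration.integral_diff)
      (use integrable_vec_cinner[OF T[OF w] v] int[OF w] in \<open>auto simp: w_def[abs_def]\<close>)
  ultimately have "AE t in halfline. T w t = 0" by (intro zero[OF w]) simp
  then show ?thesis
    by (intro exI[of _ c]) (auto elim!: eventually_mono simp: T_def w_def)
qed

lemma eigenkernel_eq_range:
  assumes z: "z \<noteq> 0" and U: "\<And>c. square_integrable halfline (usol z c)"
  shows "eigenkernel (adjoint_graph (pre_hamiltonian x \<Lambda>)) z = range (\<lambda>c. to_L2 (usol z c))"
proof
  show "range (\<lambda>c. to_L2 (usol z c)) \<subseteq> eigenkernel (adjoint_graph (pre_hamiltonian x \<Lambda>)) z"
    using usol_mem_eigenkernel[OF z U] by blast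
  show "eigenkernel (adjoint_graph (pre_hamiltonian x \<Lambda>)) z \<subseteq> range (\<lambda>c. to_L2 (usol z c))"
  proof
    fix u assume u: "u \<in> eigenkernel (adjoint_graph (pre_hamiltonian x \<Lambda>)) z"
    obtain v where v: "square_integrable halfline v" and uv: "u = to_L2 v"
      by (rule to_L2_cases)
    have "\<exists>c. AE t in halfline. t \<le> x (Suc n) \<longrightarrow> v t = usol z c t" for n
      by (rule eigenkernel_local[OF z U v]) (use u uv in auto)
    then obtain c where c: "\<And>n. AE t in halfline. t \<le> x (Suc n) \<longrightarrow> v t = usol z (c n) t"
      by metis
    \<comment> \<open>All local fits represent the same \<open>v\<close> on the first cell, which
      fixes the parameter.\<close>
    have c0: "c n = c 0" for n
    proof -
      have "AE t in halfline. t \<le> x 1 \<longrightarrow> usol z (c n - c 0) t = 0"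
        using c[of n] c[of 0]
      proof eventually_elim
        case (elim t)
        then show ?case using x_mono[of 1 "Suc n"] by (auto simp: usol_diff)
      qed
      then have "c n - c 0 = 0" by (rule usol_AE_zero[rotated]) simp
      then show ?thesis by simp
    qed
    have "AE t in halfline. t \<le> x (Suc n) \<longrightarrow> v t = usol z (c 0) t" for n
      using c[of n] unfolding c0[of n] .
    \<comment> \<open>The exceptional sets are countably many null sets, so one set serves every
      \<open>n\<close>.\<close>
    then have "AE t in halfline. \<forall>n. t \<le> x (Suc n) \<longrightarrow> v t = usol z (c 0) t"
      unfolding AE_all_countable by blast
    moreover have "AE t in halfline. 0 < t" by (rule AE_I2) simp
    ultimately have "AE t in halfline. v t = usol z (c 0) t"
    proof eventually_elim
      case (elim t)
      then show ?case using cell_bounds(2)[of t] by (meson less_imp_le)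
    qed
    then have "u = to_L2 (usol z (c 0))" unfolding uv to_L2_eq_iff[OF v U] .
    then show "u \<in> range (\<lambda>c. to_L2 (usol z c))" by blast
  qed
qed

lemma ecdim_eigenkernel:
  assumes z: "z \<noteq> 0" and U: "\<And>c. square_integrable halfline (usol z c)"
  shows "ecdim (eigenkernel (adjoint_graph (hamiltonian x \<Lambda>)) z) = enat CARD('p)"
proof -
  define L where "L c = to_L2 (usol z c)" for c
  have lin: "Vector_Spaces.linear (*s) cscale L"
  proof
    show "L (c + c') = L c + L c'" for c c'
      unfolding L_def by (simp add: plus_to_L2[OF U U] usol_add[abs_def])
    show "L (a *s c) = cscale a (L c)" for a c
      unfolding L_def by (simp add: cscale_to_L2[OF U] usol_scale[abs_def])
  qed
  have inj: "inj L"
  proof (rule injI)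
    fix c c' assume "L c = L c'"
    then have "AE t in halfline. usol z c t = usol z c' t"
      unfolding L_def to_L2_eq_iff[OF U U] .
    then have "AE t in halfline. t \<le> x 1 \<longrightarrow> usol z (c - c') t = 0"
      by eventually_elim (simp add: usol_diff)
    then have "c - c' = 0" by (rule usol_AE_zero[rotated]) simp
    then show "c = c'" by simp
  qed
  have V: "eigenkernel (adjoint_graph (hamiltonian x \<Lambda>)) z = range L"
    unfolding hamiltonian_def adjoint_graph_closure L_def[abs_def]
    by (rule eigenkernel_eq_range[OF z U])
  interpret P: finite_dimensional_vector_space_pair_1
    "(*s) :: complex \<Rightarrow> complex ^ 'p \<Rightarrow> complex ^ 'p" cart_basis cscale
    by unfold_locales
  \<comment> \<open>This supplies the finite spanning set that \<open>ecdim\<close> demands before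
    it gives a finite value.\<close>
  have "range L \<subseteq> L2.span (L ` cart_basis)"
    using P.linear_span_image[OF lin, of cart_basis] by simp
  moreover have "finite (L ` cart_basis)" using finite_cart_basis by (rule finite_imageI)
  moreover have "L2.dim (range L) = CARD('p)"
    using P.dim_image_eq[OF lin, of UNIV] inj by (simp add: vec.dim_UNIV card_cart_basis)
  ultimately show ?thesis unfolding V ecdim_def by auto
qed

end

theorem mainTheorem7:
  fixes x :: "nat \<Rightarrow> real" and \<Lambda> :: "nat \<Rightarrow> complex ^ ('p::finite) ^ 'p"
  assumes "strict_mono x" and "x 0 = 0" and "filterlim x at_top sequentially"
    and "bdd_above {gap x k | k. k \<ge> 1}"
    and "\<And>k. k \<ge> 1 \<Longrightarrow> hermitian (\<Lambda> k)"
    and "summable (\<lambda>k. (gap x (k + 1))\<^sup>2)"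
    and "\<And>k. k \<ge> 1 \<Longrightarrow> gap x k * gap x (k + 2) \<ge> (gap x (k + 1))\<^sup>2"
    and "summable (\<lambda>k. gap x (k + 2) * matrix_opnorm
      (\<Lambda> (k + 1) + (1 / gap x (k + 1) + 1 / gap x (k + 2)) *\<^sub>R mat 1))"
  shows "deficiency_plus (hamiltonian x \<Lambda>) = enat CARD('p) \<and>
    deficiency_minus (hamiltonian x \<Lambda>) = enat CARD('p)"
proof -
  interpret summable_perturbation x \<Lambda>
  proof
    show "(x (Suc (Suc k)) - x (Suc k))\<^sup>2 \<le>
        (x (Suc k) - x k) * (x (Suc (Suc (Suc k))) - x (Suc (Suc k)))" for k
      \<comment> \<open>The hypothesis is indexed from 1, the sequence \<open>e\<close> from
        0.\<close>
      using assms(7)[of "Suc k"] by (simp add: gap_def)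
    show "summable (\<lambda>k. (x (Suc k) - x k)\<^sup>2)" using assms(6) by (simp add: gap_def)
    show "summable (\<lambda>k. (x (Suc (Suc k)) - x (Suc k)) * matrix_opnorm
        (\<Lambda> (Suc k) + (1 / (x (Suc k) - x k) + 1 / (x (Suc (Suc k)) - x (Suc k))) *\<^sub>R mat 1))"
      using assms(8) by (simp add: gap_def)
  qed (use assms in auto)
  have "ecdim (eigenkernel (adjoint_graph (hamiltonian x \<Lambda>)) z) = enat CARD('p)" if "z \<noteq> 0" for z
    by (rule ecdim_eigenkernel[OF that])
      (simp add: usol_def homogeneous_sol_square_integrable[OF that])
  then show ?thesis by (simp add: deficiency_plus_def deficiency_minus_def)
qed

end
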